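(* Let $v$ be an admissible weight on $\mathbb{Z}^d$, and let $\mathcal{A}$ be either $\mathcal{A}^1_v$, or $\mathcal{A}_v$ where in the latter case $v$ additionally satisfies $v^{-1}\in\ell^1(\mathbb{Z}^d)$ and $v^{-1}\ast v^{-1}\le C_0v^{-1}$ for some constant $C_0$. Then $\mathcal{A}$ is inverse-closed in $\mathcal{B}(\ell^2(\mathbb{Z}^d))$ if and only if $\mathcal{A}^{FS}$ is inverse-closed, if and only if $\mathcal{A}^F$ is inverse-closed.
   Context: An admissible weight is a non-negative function $v$ on $\mathbb{Z}^d$ that is even, satisfies $v(0)=1$, and is submultiplicative: $v(k+l)\le v(k)v(l)$. Convolution is on $\mathbb{Z}^d$. $\mathcal{A}_v$ and $\mathcal{A}_v^1$ are the spaces of matrices $A=(a_{kl})_{k,l\in\mathbb{Z}^d}$ with finite norm $\|A\|_{\mathcal{A}_v}=\sup_{k,l}|a_{kl}|v(k-l)$, respectively $\|A\|_{\mathcal{A}^1_v}=\max\{\sup_k\sum_l|a_{kl}|v(k-l),\ \sup_l\sum_k|a_{kl}|v(k-l)\}$. $C_n=\{-n,\dots,n\}^d$, $(P_ny)(k)=\chi_{C_n}(k)y(k)$, and $A_n=P_nAP_n$ is regarded as a $(2n+1)^d\times(2n+1)^d$ matrix on $\mathbb{C}^{(2n+1)^d}$; $A_n^{-1}$ is the inverse of this finite matrix. For a $(2n+1)^d\times(2n+1)^d$ matrix $B$ indexed by $C_n$, $\|B\|_{\mathcal{A}}$ is the $\mathcal{A}$-norm of its extension by zero to $\mathbb{Z}^d\times\mathbb{Z}^d$.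 $\|\cdot\|_{op}$ is the operator norm on $\ell^2$. $\mathcal{A}$ is inverse-closed in $\mathcal{B}(\ell^2(\mathbb{Z}^d))$ if every $A\in\mathcal{A}$ that is invertible on $\ell^2(\mathbb{Z}^d)$ satisfies $A^{-1}\in\mathcal{A}$. $\mathcal{A}^{FS}=\{(A_n)_{n\in\mathbb{N}}:A_n=P_nAP_n\text{ for some }A\in\mathcal{A}\}$ is inverse-closed if for every sequence $(A_n)_{n\in\mathbb{N}}\in\mathcal{A}^{FS}$ of invertible finite sections with $\|A_n\|_{\mathcal{A}}\le C$ and $\|A_n^{-1}\|_{op}\le C$ for all $n$, one has $\|A_n^{-1}\|_{\mathcal{A}}\le C'$ for all $n$, with constants $C,C'$ not depending on $n$. $\mathcal{A}^F$ is the set of sequences $(B_n)_{n\in\mathbb{N}}$ where $B_n$ is a $(2n+1)^d\times(2n+1)^d$ matrix and $\sup_n\|B_n\|_{\mathcal{A}}<\infty$; it is inverse-closed if for every such sequence of invertible matrices with $\|B_n\|_{\mathcal{A}}\le C$ and $\|B_n^{-1}\|_{op}\le C$ for all $n$, one has $\|B_n^{-1}\|_{\mathcal{A}}\le C'$ for all $n$, with constants $C,C'$ not depending on $n$. *)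

theory Defs
  imports "HOL-Analysis.Analysis"
begin

subsection \<open>Weights and matrix spaces\<close>

type_synonym 'i cmat = "'i \<Rightarrow> 'i \<Rightarrow> complex"

definition admissible_weight :: "(int ^ 'd::finite \<Rightarrow> real) \<Rightarrow> bool" where
  "admissible_weight v \<longleftrightarrow>
     (\<forall>k. 0 \<le> v k) \<and> (\<forall>k. v (- k) = v k) \<and> v 0 = 1 \<and> (\<forall>k l. v (k + l) \<le> v k * v l)"

definition convolution ::
  "(int ^ 'd::finite \<Rightarrow> real) \<Rightarrow> (int ^ 'd \<Rightarrow> real) \<Rightarrow> int ^ 'd \<Rightarrow> real" where
  "convolution f g k = (\<Sum>\<^sub>\<infinity>l. f l * g (k - l))"

text \<open>The norms take values in \<^typ>\<open>ennreal\<close>, so they are defined for every matrix and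
  are finite exactly on the corresponding matrix space.\<close>

definition sup_norm :: "(int ^ 'd::finite \<Rightarrow> real) \<Rightarrow> (int ^ 'd) cmat \<Rightarrow> ennreal" where
  "sup_norm v A = (SUP k. SUP l. ennreal (cmod (A k l) * v (k - l)))"

definition schur_norm :: "(int ^ 'd::finite \<Rightarrow> real) \<Rightarrow> (int ^ 'd) cmat \<Rightarrow> ennreal" where
  "schur_norm v A =
     max (SUP k. \<Sum>\<^sub>\<infinity>l. ennreal (cmod (A k l) * v (k - l)))
         (SUP l. \<Sum>\<^sub>\<infinity>k. ennreal (cmod (A k l) * v (k - l)))"

definition mat_space :: "('i cmat \<Rightarrow> ennreal) \<Rightarrow> 'i cmat set" where
  "mat_space N = {A. N A < \<infinity>}"

subsection \<open>Operators on the space of square-summable sequences\<close>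

definition ell2 :: "('i \<Rightarrow> complex) set" where
  "ell2 = {x. (\<lambda>k. (cmod (x k))\<^sup>2) summable_on UNIV}"

definition ell2_norm :: "('i \<Rightarrow> complex) \<Rightarrow> real" where
  "ell2_norm x = sqrt (\<Sum>\<^sub>\<infinity>k. (cmod (x k))\<^sup>2)"

text \<open>Operators are functions on all sequences of which only the restriction to
  \<^term>\<open>ell2\<close> matters.\<close>

definition ell2_bounded_op :: "(('i \<Rightarrow> complex) \<Rightarrow> ('i \<Rightarrow> complex)) \<Rightarrow> bool" where
  "ell2_bounded_op T \<longleftrightarrow>
     (\<forall>x\<in>ell2. T x \<in> ell2) \<and>
     (\<forall>x\<in>ell2. \<forall>y\<in>ell2. T (\<lambda>k. x k + y k) = (\<lambda>k. T x k + T y k)) \<and>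
     (\<forall>c. \<forall>x\<in>ell2. T (\<lambda>k. c * x k) = (\<lambda>k. c * T x k)) \<and>
     (\<exists>K. \<forall>x\<in>ell2. ell2_norm (T x) \<le> K * ell2_norm x)"

definition op_of_mat :: "'i cmat \<Rightarrow> ('i \<Rightarrow> complex) \<Rightarrow> ('i \<Rightarrow> complex)" where
  "op_of_mat A x = (\<lambda>k. \<Sum>\<^sub>\<infinity>l. A k l * x l)"

definition mat_of_op :: "(('i \<Rightarrow> complex) \<Rightarrow> ('i \<Rightarrow> complex)) \<Rightarrow> 'i cmat" where
  "mat_of_op T k l = T (\<lambda>j. of_bool (j = l)) k"

text \<open>Meaningful for matrices that map \<^term>\<open>ell2\<close> into itself; it is only applied to
  matrices with finitely many nonzero entries.\<close>

definition op_norm :: "'i cmat \<Rightarrow> ennreal" where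
  "op_norm A = (SUP x \<in> {x \<in> ell2. ell2_norm x \<le> 1}. ennreal (ell2_norm (op_of_mat A x)))"

definition ell2_inverse :: "'i cmat \<Rightarrow> (('i \<Rightarrow> complex) \<Rightarrow> ('i \<Rightarrow> complex)) \<Rightarrow> bool" where
  "ell2_inverse A T \<longleftrightarrow>
     ell2_bounded_op (op_of_mat A) \<and> ell2_bounded_op T \<and>
     (\<forall>x\<in>ell2. T (op_of_mat A x) = x \<and> op_of_mat A (T x) = x)"

definition inverse_closed :: "('i cmat \<Rightarrow> ennreal) \<Rightarrow> bool" where
  "inverse_closed N \<longleftrightarrow>
     (\<forall>A\<in>mat_space N. \<forall>T. ell2_inverse A T \<longrightarrow> mat_of_op T \<in> mat_space N)"

subsection \<open>Finite sections\<close>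

definition cube :: "nat \<Rightarrow> (int ^ 'd::finite) set" where
  "cube n = {k. \<forall>i. \<bar>k $ i\<bar> \<le> int n}"

text \<open>A matrix indexed by \<^term>\<open>cube n\<close> is represented by its extension by zero.\<close>

definition cube_mats :: "nat \<Rightarrow> (int ^ 'd::finite) cmat set" where
  "cube_mats n = {B. \<forall>k l. k \<notin> cube n \<or> l \<notin> cube n \<longrightarrow> B k l = 0}"

text \<open>The matrix of \<open>P\<^sub>n A P\<^sub>n\<close>, where \<open>P\<^sub>n\<close> is multiplication by the indicator of the cube.\<close>

definition finite_section :: "(int ^ 'd::finite) cmat \<Rightarrow> nat \<Rightarrow> (int ^ 'd) cmat" where
  "finite_section A n = (\<lambda>k l. indicator (cube n) k * A k l * indicator (cube n) l)"

definition cube_inverse :: "nat \<Rightarrow> (int ^ 'd::finite) cmat \<Rightarrow> (int ^ 'd) cmat \<Rightarrow> bool" where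
  "cube_inverse n A B \<longleftrightarrow>
     B \<in> cube_mats n \<and>
     (\<forall>k\<in>cube n. \<forall>l\<in>cube n.
        (\<Sum>j\<in>cube n. A k j * B j l) = of_bool (k = l) \<and>
        (\<Sum>j\<in>cube n. B k j * A j l) = of_bool (k = l))"

definition FS_seqs :: "((int ^ 'd::finite) cmat \<Rightarrow> ennreal) \<Rightarrow> (nat \<Rightarrow> (int ^ 'd) cmat) set" where
  "FS_seqs N = {finite_section A |A. A \<in> mat_space N}"

definition F_seqs :: "((int ^ 'd::finite) cmat \<Rightarrow> ennreal) \<Rightarrow> (nat \<Rightarrow> (int ^ 'd) cmat) set" where
  "F_seqs N = {B. (\<forall>n. B n \<in> cube_mats n) \<and> (SUP n. N (B n)) < \<infinity>}"

text \<open>The bound \<open>C'\<close> may depend on the sequence, but not on \<open>n\<close>.\<close>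

definition seq_inverse_closed ::
  "((int ^ 'd::finite) cmat \<Rightarrow> ennreal) \<Rightarrow> (nat \<Rightarrow> (int ^ 'd) cmat) set \<Rightarrow> bool" where
  "seq_inverse_closed N S \<longleftrightarrow>
     (\<forall>A\<in>S. \<forall>B. \<forall>C::real.
        (\<forall>n. cube_inverse n (A n) (B n)) \<and>
        (\<forall>n. N (A n) \<le> ennreal C) \<and> (\<forall>n. op_norm (B n) \<le> ennreal C) \<longrightarrow>
        (\<exists>C'::real. \<forall>n. N (B n) \<le> ennreal C'))"

end

theory Submission
  imports Defs
begin

text \<open>
  A bounded sequence of cube matrices is turned into a single matrix on \<open>\<int>\<^sup>d\<close> by placing
  translated copies along disjoint cubes, with the identity elsewhere; its inverse contains the
  inverses of all members of the sequence, so inverse-closedness of \<open>\<A>\<close> yields that of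
  \<open>\<A>\<^sup>F\<close>, which contains \<open>\<A>\<^sup>F\<^sup>S\<close>.

  Conversely, let \<open>A \<in> \<A>\<close> be invertible on \<open>\<ell>\<^sup>2\<close>. The finite sections of \<open>A\<close> may be singular, but those
  of the positive definite Gram matrix \<open>M = A\<^sup>* A\<close> have uniformly bounded inverses \<open>B\<^sub>n\<close>. By
  assumption the \<open>B\<^sub>n\<close> are bounded in \<open>\<A>\<close>, hence so are the products \<open>B\<^sub>n A\<^sup>*\<close>, and these converge
  entrywise to \<open>A\<^sup>-\<^sup>1 = M\<^sup>-\<^sup>1 A\<^sup>*\<close>. For the convergence it suffices that all matrices
  involved act boundedly on \<open>\<ell>\<^sup>\<infinity>\<close> and that sequences in \<open>\<ell>\<^sup>2\<close> vanish at infinity.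
\<close>

subsection \<open>Finite systems of linear equations\<close>

text \<open>Gaussian elimination, by induction on the equations with coefficients and unknowns
  arbitrary. A vacuous equation is dropped; otherwise one pivot unknown is eliminated, which lowers
  both counts by one.\<close>

lemma underdetermined_system_nontrivial:
  fixes a :: "'e \<Rightarrow> 'u \<Rightarrow> complex"
  assumes "finite E" "finite U" "card E < card U"
  shows "\<exists>x. (\<exists>u\<in>U. x u \<noteq> 0) \<and> (\<forall>e\<in>E. (\<Sum>u\<in>U. a e u * x u) = 0)"
  using assms
proof (induction E arbitrary: U a rule: finite_induct)
  case empty
  then have "U \<noteq> {}" by auto
  then show ?case by (intro exI[of _ "\<lambda>_. 1"]) auto
next
  case (insert e E)
  show ?case
  proof (cases "\<forall>u\<in>U. a e u = 0")
    case True
    have "card E < card U" using insert by simp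
    from insert.IH[OF insert.prems(1) this, of a] obtain x where
      "\<exists>u\<in>U. x u \<noteq> 0" "\<forall>e\<in>E. (\<Sum>u\<in>U. a e u * x u) = 0"
      by blast
    with True show ?thesis by (intro exI[of _ x]) auto
  next
    case False
    then obtain u0 where u0: "u0 \<in> U" "a e u0 \<noteq> 0" by auto
    let ?U = "U - {u0}"
    \<comment> \<open>Coefficients of the remaining equations after \<open>u0\<close> has been
      eliminated by means of equation \<open>e\<close>.\<close>
    define b where "b f u = a f u - a f u0 * a e u / a e u0" for f u
    have "card E < card ?U" using insert u0 by simp
    from insert.IH[OF _ this, of b] insert.prems obtain x where
      x: "\<exists>u\<in>?U. x u \<noteq> 0" "\<And>f. f \<in> E \<Longrightarrow> (\<Sum>u\<in>?U. b f u * x u) = 0"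
      by auto
    define s where "s = (\<Sum>u\<in>?U. a e u * x u)"
    \<comment> \<open>Back substitution: the value at \<open>u0\<close> makes equation
      \<open>e\<close> hold and turns each reduced equation back into the original one.\<close>
    define y where "y = x(u0 := - s / a e u0)"
    have split: "(\<Sum>u\<in>U. a f u * y u) = (\<Sum>u\<in>?U. a f u * x u) - a f u0 * s / a e u0" for f
    proof -
      have "(\<Sum>u\<in>U. a f u * y u) = a f u0 * y u0 + (\<Sum>u\<in>?U. a f u * y u)"
        using u0 insert.prems by (simp add: sum.remove)
      also have "(\<Sum>u\<in>?U. a f u * y u) = (\<Sum>u\<in>?U. a f u * x u)"
        by (intro sum.cong) (auto simp: y_def)
      finally show ?thesis by (simp add: y_def)
    qed
    have "(\<Sum>u\<in>?U. b f u * x u) = (\<Sum>u\<in>?U. a f u * x u) - a f u0 * s / a e u0" for f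
      by (simp add: b_def s_def left_diff_distrib sum_subtractf sum_distrib_left sum_divide_distrib
          mult.assoc)
    then have "(\<Sum>u\<in>U. a f u * y u) = 0" if "f \<in> insert e E" for f
      using that x(2) u0 unfolding split by (auto simp: s_def)
    moreover have "\<exists>u\<in>U. y u \<noteq> 0" using x(1) by (auto simp: y_def)
    ultimately show ?thesis by blast
  qed
qed

text \<open>The right-hand side is homogenised by an extra unknown \<open>None\<close> with
  coefficient \<open>- y k\<close>. There is then one more unknown than equations, so a nontrivial
  solution exists; injectivity forces its \<open>None\<close> component to be nonzero, and dividing
  by it solves the original system.\<close>

lemma injective_system_solvable:
  fixes M :: "'i cmat"
  assumes C: "finite C"
    and inj: "\<And>x. \<forall>k\<in>C. (\<Sum>l\<in>C. M k l * x l) = 0 \<Longrightarrow> \<forall>l\<in>C. x l = 0"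
  shows "\<exists>x. \<forall>k\<in>C. (\<Sum>l\<in>C. M k l * x l) = y k"
proof -
  define a where "a k u = (case u of None \<Rightarrow> - y k | Some l \<Rightarrow> M k l)" for k u
  have sum_U: "(\<Sum>u\<in>insert None (Some ` C). a k u * x u) = (\<Sum>l\<in>C. M k l * x (Some l)) - y k * x None"
    for k x using C by (simp add: sum.reindex a_def)
  have "card C < card (insert None (Some ` C))" using C by (simp add: card_image)
  from underdetermined_system_nontrivial[OF C _ this, of a] C obtain x where
    nz: "\<exists>u\<in>insert None (Some ` C). x u \<noteq> 0"
    and x: "\<And>k. k \<in> C \<Longrightarrow> (\<Sum>l\<in>C. M k l * x (Some l)) = y k * x None"
    unfolding sum_U by auto
  have "x None \<noteq> 0"
  proof
    assume 0: "x None = 0"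
    have "x (Some l) = 0" if "l \<in> C" for l
      using inj[of "\<lambda>l. x (Some l)"] x 0 that by simp
    with 0 nz show False by auto
  qed
  then have "\<forall>k\<in>C. (\<Sum>l\<in>C. M k l * (x (Some l) / x None)) = y k"
    using x by (simp add: sum_divide_distrib[symmetric])
  then show ?thesis by (rule exI[of _ "\<lambda>l. x (Some l) / x None"])
qed

text \<open>Solving for the unit vectors gives the columns of a right inverse B. It is also a left
  inverse, because M (B M - I) = 0 and M is injective.\<close>

lemma injective_imp_two_sided_inverse:
  fixes M :: "'i cmat"
  assumes C: "finite C"
    and inj: "\<And>x. \<forall>k\<in>C. (\<Sum>l\<in>C. M k l * x l) = 0 \<Longrightarrow> \<forall>l\<in>C. x l = 0"
  obtains B where "\<And>k l. k \<notin> C \<or> l \<notin> C \<Longrightarrow> B k l = 0"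
    "\<And>k l. k \<in> C \<Longrightarrow> l \<in> C \<Longrightarrow> (\<Sum>j\<in>C. M k j * B j l) = of_bool (k = l)"
    "\<And>k l. k \<in> C \<Longrightarrow> l \<in> C \<Longrightarrow> (\<Sum>j\<in>C. B k j * M j l) = of_bool (k = l)"
proof -
  have "\<forall>l. \<exists>x. \<forall>k\<in>C. (\<Sum>j\<in>C. M k j * x j) = of_bool (k = l)"
    using injective_system_solvable[of C M, OF C inj] by simp
  then obtain X where X: "\<And>k l. k \<in> C \<Longrightarrow> (\<Sum>j\<in>C. M k j * X l j) = of_bool (k = l)"
    by metis
  define B where "B k l = (if k \<in> C \<and> l \<in> C then X l k else 0)" for k l
  have right: "(\<Sum>j\<in>C. M k j * B j l) = of_bool (k = l)" if "k \<in> C" "l \<in> C" for k l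
  proof -
    have "(\<Sum>j\<in>C. M k j * B j l) = (\<Sum>j\<in>C. M k j * X l j)"
      by (intro sum.cong) (auto simp: B_def that)
    with X that show ?thesis by simp
  qed
  have left: "(\<Sum>j\<in>C. B k j * M j l) = of_bool (k = l)" if k: "k \<in> C" and l: "l \<in> C" for k l
  proof -
    define z where "z i = (\<Sum>j\<in>C. B i j * M j l) - of_bool (i = l)" for i
    have "(\<Sum>i\<in>C. M m i * z i) = 0" if m: "m \<in> C" for m
    proof -
      have "(\<Sum>i\<in>C. M m i * (\<Sum>j\<in>C. B i j * M j l)) = (\<Sum>j\<in>C. (\<Sum>i\<in>C. M m i * B i j) * M j l)"
        unfolding sum_distrib_left sum_distrib_right by (subst sum.swap) (simp add: mult.assoc)
      also have "\<dots> = (\<Sum>j\<in>C. of_bool (m = j) * M j l)"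
        by (intro sum.cong) (auto simp: right m)
      also have "\<dots> = M m l" using C m by (simp add: sum.remove of_bool_def if_distrib[of "\<lambda>x. x * _"] cong: if_cong)
      finally show ?thesis
        using C l by (simp add: z_def right_diff_distrib sum_subtractf of_bool_def if_distrib[of "\<lambda>x. _ * x"] cong: if_cong)
    qed
    with inj[of z] k show ?thesis by (simp add: z_def)
  qed
  show ?thesis by (rule that[of B]) (use left right in \<open>auto simp: B_def\<close>)
qed

subsection \<open>Square-summable sequences and block diagonal operators\<close>

lemma ell2_finite_support:
  assumes "finite C" "\<And>k. k \<notin> C \<Longrightarrow> x k = 0"
  shows "x \<in> ell2" "ell2_norm x = L2_set (\<lambda>k. cmod (x k)) C"
proof -
  have "((\<lambda>k. (cmod (x k))\<^sup>2) has_sum (\<Sum>k\<in>C. (cmod (x k))\<^sup>2)) UNIV"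
    using assms by (intro has_sum_finite_neutralI) auto
  then show "x \<in> ell2" "ell2_norm x = L2_set (\<lambda>k. cmod (x k)) C"
    by (auto simp: ell2_def ell2_norm_def L2_set_def has_sum_imp_summable infsumI)
qed

lemma L2_set_le_ell2_norm:
  assumes "x \<in> ell2" "finite C"
  shows "L2_set (\<lambda>k. cmod (x k)) C \<le> ell2_norm x"
  using assms unfolding ell2_def ell2_norm_def L2_set_def
  by (auto intro!: real_sqrt_le_mono finite_sum_le_infsum)

lemma ell2_norm_nonneg [simp]: "0 \<le> ell2_norm x"
  unfolding ell2_norm_def by (simp add: infsum_nonneg)

lemma ell2_norm_le_finite:
  assumes "\<And>F. finite F \<Longrightarrow> L2_set (\<lambda>k. cmod (x k)) F \<le> K"
  shows "x \<in> ell2" "ell2_norm x \<le> K"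
proof -
  have K: "0 \<le> K" using assms[of "{}"] by simp
  have fin: "(\<Sum>k\<in>F. (cmod (x k))\<^sup>2) \<le> K\<^sup>2" if "finite F" for F
    using assms[OF that] K unfolding L2_set_def
    by (metis real_sqrt_le_iff real_sqrt_unique)
  then show 1: "x \<in> ell2"
    unfolding ell2_def by (auto intro!: nonneg_bdd_above_summable_on bdd_aboveI[of _ "K\<^sup>2"])
  then have "(\<Sum>\<^sub>\<infinity>k. (cmod (x k))\<^sup>2) \<le> K\<^sup>2"
    using fin by (intro infsum_le_finite_sums) (auto simp: ell2_def)
  then show "ell2_norm x \<le> K"
    using K by (simp add: ell2_norm_def real_le_lsqrt)
qed

lemma cmod_le_ell2_norm:
  assumes "x \<in> ell2"
  shows "cmod (x k) \<le> ell2_norm x"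
  using L2_set_le_ell2_norm[OF assms, of "{k}"] by simp

text \<open>The decay at infinity behind the later convergence proof: \<open>m\<close> indices with
  entries of modulus at least \<open>\<epsilon>\<close> contribute at least m times the square of
  \<open>\<epsilon>\<close> to the squared norm.\<close>

lemma ell2_finite_large:
  assumes "x \<in> ell2" "0 < \<epsilon>"
  shows "finite {k. \<epsilon> \<le> cmod (x k)}"
proof (rule ccontr)
  assume "infinite {k. \<epsilon> \<le> cmod (x k)}"
  moreover obtain m where m: "(ell2_norm x)\<^sup>2 < real m * \<epsilon>\<^sup>2"
    using reals_Archimedean3[of "\<epsilon>\<^sup>2"] assms(2) by auto
  ultimately obtain F where F: "F \<subseteq> {k. \<epsilon> \<le> cmod (x k)}" "finite F" "card F = m"
    using infinite_arbitrarily_large by blast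
  have "real m * \<epsilon>\<^sup>2 = (\<Sum>k\<in>F. \<epsilon>\<^sup>2)" using F by simp
  also have "\<dots> \<le> (\<Sum>k\<in>F. (cmod (x k))\<^sup>2)"
    using F assms(2) by (intro sum_mono power_mono) auto
  also have "\<dots> = (L2_set (\<lambda>k. cmod (x k)) F)\<^sup>2"
    by (simp add: L2_set_def sum_nonneg)
  also have "\<dots> \<le> (ell2_norm x)\<^sup>2"
    by (intro power_mono L2_set_le_ell2_norm assms F) auto
  finally show False using m by simp
qed

lemma op_of_mat_finite_row:
  assumes "finite C" "\<And>l. l \<notin> C \<Longrightarrow> A k l = 0"
  shows "op_of_mat A x k = (\<Sum>l\<in>C. A k l * x l)"
  unfolding op_of_mat_def using assms by (intro infsumI has_sum_finite_neutralI) auto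

lemma mat_of_op_of_mat: "mat_of_op (op_of_mat A) = A"
proof (intro ext)
  fix k l
  have "((\<lambda>j. A k j * of_bool (j = l)) has_sum A k l) UNIV"
    by (rule has_sum_finite_neutralI[of "{l}"]) auto
  then show "mat_of_op (op_of_mat A) k l = A k l"
    by (simp add: mat_of_op_def op_of_mat_def infsumI)
qed

text \<open>The modulus of each entry is split into two square roots before Cauchy-Schwarz. The row
  sums then contribute one factor \<open>s\<close> to the squared norm and, after exchanging the
  sums, the column sums contribute the other.\<close>

lemma finite_schur_test:
  fixes A :: "'i cmat"
  assumes I: "finite I"
    and row: "\<And>k. k \<in> I \<Longrightarrow> (\<Sum>l\<in>I. cmod (A k l)) \<le> s"
    and col: "\<And>l. l \<in> I \<Longrightarrow> (\<Sum>k\<in>I. cmod (A k l)) \<le> s"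
    and s: "0 \<le> s"
  shows "L2_set (\<lambda>k. cmod (\<Sum>l\<in>I. A k l * x l)) I \<le> s * L2_set (\<lambda>k. cmod (x k)) I"
proof -
  have entry: "(cmod (\<Sum>l\<in>I. A k l * x l))\<^sup>2 \<le> s * (\<Sum>l\<in>I. cmod (A k l) * (cmod (x l))\<^sup>2)"
    if k: "k \<in> I" for k
  proof -
    have "cmod (\<Sum>l\<in>I. A k l * x l) \<le> (\<Sum>l\<in>I. \<bar>sqrt (cmod (A k l))\<bar> * \<bar>sqrt (cmod (A k l)) * cmod (x l)\<bar>)"
      by (rule order_trans[OF norm_sum]) (simp add: norm_mult abs_mult mult.assoc[symmetric])
    also have "\<dots> \<le> L2_set (\<lambda>l. sqrt (cmod (A k l))) I * L2_set (\<lambda>l. sqrt (cmod (A k l)) * cmod (x l)) I"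
      by (rule L2_set_mult_ineq)
    finally have "(cmod (\<Sum>l\<in>I. A k l * x l))\<^sup>2
        \<le> (L2_set (\<lambda>l. sqrt (cmod (A k l))) I * L2_set (\<lambda>l. sqrt (cmod (A k l)) * cmod (x l)) I)\<^sup>2"
      by (intro power_mono) auto
    also have "\<dots> = (\<Sum>l\<in>I. cmod (A k l)) * (\<Sum>l\<in>I. cmod (A k l) * (cmod (x l))\<^sup>2)"
      by (simp add: L2_set_def power_mult_distrib sum_nonneg)
    also have "\<dots> \<le> s * (\<Sum>l\<in>I. cmod (A k l) * (cmod (x l))\<^sup>2)"
      by (intro mult_right_mono row k sum_nonneg) auto
    finally show ?thesis .
  qed
  have "(\<Sum>k\<in>I. (cmod (\<Sum>l\<in>I. A k l * x l))\<^sup>2) \<le> (\<Sum>k\<in>I. s * (\<Sum>l\<in>I. cmod (A k l) * (cmod (x l))\<^sup>2))"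
    by (intro sum_mono entry)
  also have "\<dots> = s * (\<Sum>l\<in>I. (\<Sum>k\<in>I. cmod (A k l)) * (cmod (x l))\<^sup>2)"
    unfolding sum_distrib_left[symmetric] sum_distrib_right by (subst sum.swap) simp
  also have "\<dots> \<le> s * (\<Sum>l\<in>I. s * (cmod (x l))\<^sup>2)"
    by (intro mult_left_mono sum_mono mult_right_mono col s) auto
  also have "\<dots> = s\<^sup>2 * (\<Sum>l\<in>I. (cmod (x l))\<^sup>2)"
    by (simp add: sum_distrib_left[symmetric] power2_eq_square)
  finally have "(L2_set (\<lambda>k. cmod (\<Sum>l\<in>I. A k l * x l)) I)\<^sup>2 \<le> (s * L2_set (\<lambda>k. cmod (x k)) I)\<^sup>2"
    by (simp add: L2_set_def power_mult_distrib sum_nonneg)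
  then show ?thesis by (rule power2_le_imp_le) (simp add: s)
qed

section \<open>Operators that are block diagonal along finite fibres\<close>

lemma fibre_operator:
  fixes A :: "'i cmat" and f :: "'i \<Rightarrow> 'j"
  assumes fin: "\<And>j. finite (f -` {j})"
    and off: "\<And>k l. f k \<noteq> f l \<Longrightarrow> A k l = 0"
  shows "op_of_mat A x k = (\<Sum>l\<in>f -` {f k}. A k l * x l)"
  by (intro op_of_mat_finite_row fin off) auto

text \<open>The fibres of \<open>f\<close> are the diagonal blocks. Squared norms add up over
  blocks, so a common bound for the blocks bounds the operator; a finite set \<open>F\<close> is
  first enlarged to the union of the fibres it meets.\<close>

lemma ell2_bounded_op_fibrewise:
  fixes A :: "'i cmat" and f :: "'i \<Rightarrow> 'j"
  assumes fin: "\<And>j. finite (f -` {j})"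
    and off: "\<And>k l. f k \<noteq> f l \<Longrightarrow> A k l = 0"
    and bound: "\<And>j x. L2_set (\<lambda>k. cmod (\<Sum>l\<in>f -` {j}. A k l * x l)) (f -` {j})
                  \<le> K * L2_set (\<lambda>k. cmod (x k)) (f -` {j})"
    and K: "0 \<le> K"
  shows "ell2_bounded_op (op_of_mat A)"
proof -
  note op = fibre_operator[of f A, OF fin off]
  have le: "L2_set (\<lambda>k. cmod (op_of_mat A x k)) F \<le> K * ell2_norm x" if "x \<in> ell2" "finite F" for x F
  proof -
    have fibre: "(\<Sum>k\<in>f -` {j}. (cmod (op_of_mat A x k))\<^sup>2) \<le> K\<^sup>2 * (\<Sum>k\<in>f -` {j}. (cmod (x k))\<^sup>2)" for j
    proof -
      have "(\<Sum>k\<in>f -` {j}. (cmod (op_of_mat A x k))\<^sup>2)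
          = (L2_set (\<lambda>k. cmod (\<Sum>l\<in>f -` {j}. A k l * x l)) (f -` {j}))\<^sup>2"
        by (simp add: L2_set_def sum_nonneg op)
      also have "\<dots> \<le> (K * L2_set (\<lambda>k. cmod (x k)) (f -` {j}))\<^sup>2"
        by (intro power_mono bound) auto
      finally show ?thesis by (simp add: L2_set_def power_mult_distrib sum_nonneg)
    qed
    have U: "f -` f ` F = (\<Union>j\<in>f ` F. f -` {j})" by auto
    have split: "sum g (f -` f ` F) = (\<Sum>j\<in>f ` F. sum g (f -` {j}))" for g :: "'i \<Rightarrow> real"
      unfolding U using \<open>finite F\<close> fin by (intro sum.UNION_disjoint) auto
    have finU: "finite (f -` f ` F)" unfolding U using \<open>finite F\<close> fin by blast
    have "(\<Sum>k\<in>F. (cmod (op_of_mat A x k))\<^sup>2) \<le> (\<Sum>k\<in>f -` f ` F. (cmod (op_of_mat A x k))\<^sup>2)"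
      using finU by (intro sum_mono2) auto
    also have "\<dots> \<le> K\<^sup>2 * (\<Sum>k\<in>f -` f ` F. (cmod (x k))\<^sup>2)"
      unfolding split sum_distrib_left by (intro sum_mono order_trans[OF fibre]) (simp add: sum_distrib_left)
    also have "\<dots> = (K * L2_set (\<lambda>k. cmod (x k)) (f -` f ` F))\<^sup>2"
      by (simp add: L2_set_def power_mult_distrib sum_nonneg)
    also have "\<dots> \<le> (K * ell2_norm x)\<^sup>2"
      using that K finU by (intro power_mono mult_left_mono L2_set_le_ell2_norm) auto
    finally show ?thesis
      unfolding L2_set_def by (intro real_le_lsqrt) (use K in auto)
  qed
  have add: "op_of_mat A (\<lambda>k. x k + y k) = (\<lambda>k. op_of_mat A x k + op_of_mat A y k)" for x y
    by (simp add: op ring_distribs sum.distrib fun_eq_iff)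
  have scale: "op_of_mat A (\<lambda>k. c * x k) = (\<lambda>k. c * op_of_mat A x k)" for c x
    by (simp add: op sum_distrib_left fun_eq_iff mult.left_commute)
  have "\<exists>K. \<forall>x\<in>ell2. ell2_norm (op_of_mat A x) \<le> K * ell2_norm x"
    using ell2_norm_le_finite(2)[OF le] by blast
  moreover have "\<forall>x\<in>ell2. op_of_mat A x \<in> ell2"
    using ell2_norm_le_finite(1)[OF le] by blast
  ultimately show ?thesis
    unfolding ell2_bounded_op_def using add scale by blast
qed

text \<open>Both matrices act within one finite fibre at a time, so associativity reduces to an
  exchange of finite sums.\<close>

lemma fibrewise_left_inverse:
  fixes A :: "'i cmat" and f :: "'i \<Rightarrow> 'j"
  assumes fin: "\<And>j. finite (f -` {j})"
    and offA: "\<And>k l. f k \<noteq> f l \<Longrightarrow> A k l = 0"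
    and offB: "\<And>k l. f k \<noteq> f l \<Longrightarrow> B k l = 0"
    and inv: "\<And>k l. f k = f l \<Longrightarrow> (\<Sum>m\<in>f -` {f k}. B k m * A m l) = of_bool (k = l)"
  shows "op_of_mat B (op_of_mat A x) = x"
proof
  fix k
  have "op_of_mat B (op_of_mat A x) k = (\<Sum>m\<in>f -` {f k}. B k m * op_of_mat A x m)"
    by (rule fibre_operator[of f B, OF fin offB])
  also have "\<dots> = (\<Sum>m\<in>f -` {f k}. B k m * (\<Sum>l\<in>f -` {f k}. A m l * x l))"
    by (intro sum.cong refl) (auto simp: fibre_operator[of f A, OF fin offA])
  also have "\<dots> = (\<Sum>l\<in>f -` {f k}. (\<Sum>m\<in>f -` {f k}. B k m * A m l) * x l)"
    unfolding sum_distrib_left sum_distrib_right by (subst sum.swap) (simp add: mult.assoc)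
  also have "\<dots> = (\<Sum>l\<in>f -` {f k}. of_bool (k = l) * x l)"
    by (intro sum.cong refl) (auto simp: inv)
  also have "\<dots> = x k"
    using fin by (simp add: of_bool_def if_distrib[of "\<lambda>x. x * _"] cong: if_cong)
  finally show "op_of_mat B (op_of_mat A x) k = x k" .
qed

subsection \<open>Solid matrix norms\<close>

text \<open>Evenness and submultiplicativity give v(k)^2 = v(k) v(-k) >= v(0) = 1.\<close>

lemma admissible_weight_ge_1:
  assumes "admissible_weight v"
  shows "1 \<le> v k"
proof -
  have "v (k + (- k)) \<le> v k * v (- k)" "v (- k) = v k" "v 0 = 1" "0 \<le> v k"
    using assms unfolding admissible_weight_def by blast+
  then have "1\<^sup>2 \<le> (v k)\<^sup>2" by (simp add: power2_eq_square)
  then show ?thesis using \<open>0 \<le> v k\<close> by (rule power2_le_imp_le)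
qed

definition mat_transpose :: "'i cmat \<Rightarrow> 'i cmat" where
  "mat_transpose A = (\<lambda>k l. A l k)"

definition mat_adjoint :: "'i cmat \<Rightarrow> 'i cmat" where
  "mat_adjoint A = (\<lambda>k l. cnj (A l k))"

definition mat_mult :: "'i cmat \<Rightarrow> 'i cmat \<Rightarrow> 'i cmat" where
  "mat_mult A B = (\<lambda>k l. \<Sum>\<^sub>\<infinity>j. A k j * B j l)"

lemma mat_transpose_mult: "mat_transpose (mat_mult A B) = mat_mult (mat_transpose B) (mat_transpose A)"
  by (simp add: mat_transpose_def mat_mult_def mult.commute)

text \<open>Only finite sums and a real bound occur, which keeps infinite series and extended reals
  out of most estimates. Column bounds become row bounds of the transpose, because the weight is
  even.\<close>

definition row_bounded ::
  "(int ^ 'd::finite) set set \<Rightarrow> (int ^ 'd \<Rightarrow> real) \<Rightarrow> (int ^ 'd) cmat \<Rightarrow> real \<Rightarrow> bool" where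
  "row_bounded \<F> v A r \<longleftrightarrow> (\<forall>k. \<forall>F\<in>\<F>. (\<Sum>l\<in>F. cmod (A k l) * v (k - l)) \<le> r)"

text \<open>Both norms of the theorem are of this form: \<open>\<F>\<close> consists of all finite sets for the
  Schur norm, and of the sets with at most one element for the supremum norm.\<close>

locale solid_matrix_norm =
  fixes v :: "int ^ 'd::finite \<Rightarrow> real"
    and N :: "(int ^ 'd) cmat \<Rightarrow> ennreal"
    and \<F> :: "(int ^ 'd) set set"
    and c :: real
  assumes weight: "admissible_weight v"
    and N_le_iff: "0 \<le> r \<Longrightarrow>
          N A \<le> ennreal r \<longleftrightarrow> row_bounded \<F> v A r \<and> row_bounded \<F> v (mat_transpose A) r"
    and empty_in: "{} \<in> \<F>"
    and finite_in: "F \<in> \<F> \<Longrightarrow> finite F"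
    and subset_in: "F \<in> \<F> \<Longrightarrow> G \<subseteq> F \<Longrightarrow> G \<in> \<F>"
    and translate_in: "F \<in> \<F> \<Longrightarrow> (\<lambda>l. l + t) ` F \<in> \<F>"
    and const_ge_1: "1 \<le> c"
    and row_sum_le: "row_bounded \<F> v A a \<Longrightarrow> finite J \<Longrightarrow> (\<Sum>l\<in>J. cmod (A k l)) \<le> c * a"
    and row_mult_le: "row_bounded \<F> v A a \<Longrightarrow> row_bounded \<F> v B b \<Longrightarrow> F \<in> \<F> \<Longrightarrow> finite J \<Longrightarrow>
          (\<Sum>l\<in>F. (\<Sum>j\<in>J. cmod (A k j) * cmod (B j l)) * v (k - l)) \<le> c * a * b"

text \<open>As v >= 1, plain row sums are at most the weighted ones, and v(k - l) <= v(k - j) v(j -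
  l) distributes the weight over the two factors of a product. Hence the constant 1.\<close>

lemma solid_matrix_norm_schur:
  assumes v: "admissible_weight v"
  shows "solid_matrix_norm v (schur_norm v) {F. finite F} 1"
proof
  note v1 = admissible_weight_ge_1[OF v]
  have v0: "0 \<le> v k" for k using v1[of k] by simp
  have even: "v (k - l) = v (l - k)" for k l
    using v unfolding admissible_weight_def by (metis minus_diff_eq)
  have sub: "v (k - l) \<le> v (k - j) * v (j - l)" for k j l
    using v unfolding admissible_weight_def by (metis diff_add_cancel diff_diff_eq2)
  have infsum_le: "(\<Sum>\<^sub>\<infinity>l. ennreal (f l)) \<le> ennreal r \<longleftrightarrow> (\<forall>F\<in>{F. finite F}. sum f F \<le> r)"
    if f: "\<And>l. 0 \<le> f l" and "0 \<le> r" for f :: "int ^ 'd \<Rightarrow> real" and r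
  proof -
    have "(\<Sum>\<^sub>\<infinity>l. ennreal (f l)) = (SUP F\<in>{F. finite F \<and> F \<subseteq> UNIV}. \<Sum>l\<in>F. ennreal (f l))"
      by (rule nonneg_infsum_complete) simp
    then show ?thesis using that by (simp add: SUP_le_iff sum_ennreal)
  qed
  show "schur_norm v A \<le> ennreal r \<longleftrightarrow>
      row_bounded {F. finite F} v A r \<and> row_bounded {F. finite F} v (mat_transpose A) r"
    if "0 \<le> r" for A r
  proof -
    have "(\<Sum>\<^sub>\<infinity>l. ennreal (cmod (A k l) * v (k - l))) \<le> ennreal r \<longleftrightarrow>
        (\<forall>F\<in>{F. finite F}. (\<Sum>l\<in>F. cmod (A k l) * v (k - l)) \<le> r)" for k
      by (intro infsum_le that) (simp add: v0)
    moreover have "(\<Sum>\<^sub>\<infinity>k. ennreal (cmod (A k l) * v (k - l))) \<le> ennreal r \<longleftrightarrow>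
        (\<forall>F\<in>{F. finite F}. (\<Sum>k\<in>F. cmod (A k l) * v (l - k)) \<le> r)" for l
      unfolding even[of l] by (intro infsum_le that) (simp add: v0)
    ultimately show ?thesis
      unfolding schur_norm_def max.bounded_iff SUP_le_iff row_bounded_def mat_transpose_def by simp
  qed
  show "(\<Sum>l\<in>J. cmod (A k l)) \<le> 1 * a"
    if "row_bounded {F. finite F} v A a" "finite J" for A a J k
  proof -
    have "(\<Sum>l\<in>J. cmod (A k l)) \<le> (\<Sum>l\<in>J. cmod (A k l) * v (k - l))"
      by (intro sum_mono) (use v1 in \<open>simp add: mult_le_cancel_left1\<close>)
    also have "\<dots> \<le> a" using that unfolding row_bounded_def by blast
    finally show ?thesis by simp
  qed
  show "(\<Sum>l\<in>F. (\<Sum>j\<in>J. cmod (A k j) * cmod (B j l)) * v (k - l)) \<le> 1 * a * b"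
    if A: "row_bounded {F. finite F} v A a" and B: "row_bounded {F. finite F} v B b"
      and "F \<in> {F. finite F}" "finite J" for A a B b F J k
  proof -
    have "0 \<le> b" using B unfolding row_bounded_def by (force dest: spec bspec[of _ _ "{}"])
    have "(\<Sum>l\<in>F. (\<Sum>j\<in>J. cmod (A k j) * cmod (B j l)) * v (k - l))
        \<le> (\<Sum>l\<in>F. \<Sum>j\<in>J. (cmod (A k j) * v (k - j)) * (cmod (B j l) * v (j - l)))"
      unfolding sum_distrib_right
    proof (intro sum_mono)
      fix l j
      have "cmod (A k j) * cmod (B j l) * v (k - l) \<le> cmod (A k j) * cmod (B j l) * (v (k - j) * v (j - l))"
        by (intro mult_left_mono sub) auto
      then show "cmod (A k j) * cmod (B j l) * v (k - l)
          \<le> (cmod (A k j) * v (k - j)) * (cmod (B j l) * v (j - l))"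
        by (simp add: mult_ac)
    qed
    also have "\<dots> = (\<Sum>j\<in>J. (cmod (A k j) * v (k - j)) * (\<Sum>l\<in>F. cmod (B j l) * v (j - l)))"
      by (subst sum.swap) (simp add: sum_distrib_left)
    also have "\<dots> \<le> (\<Sum>j\<in>J. (cmod (A k j) * v (k - j)) * b)"
      using that v0 by (intro sum_mono mult_left_mono) (auto simp: row_bounded_def)
    also have "\<dots> = (\<Sum>j\<in>J. cmod (A k j) * v (k - j)) * b" by (simp add: sum_distrib_right)
    also have "\<dots> \<le> a * b"
      using that \<open>0 \<le> b\<close> by (intro mult_right_mono) (auto simp: row_bounded_def)
    finally show ?thesis by simp
  qed
qed (use v finite_subset in auto)

text \<open>Entries are dominated by a multiple of the reciprocal weight. In the constant, the sum
  of the reciprocal weight controls row sums, \<open>C0\<close> controls products through the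
  convolution inequality, and 1 secures \<open>const_ge_1\<close>.\<close>

lemma solid_matrix_norm_sup:
  assumes v: "admissible_weight v"
    and sum: "(\<lambda>k. \<bar>inverse (v k)\<bar>) summable_on UNIV"
    and conv: "\<And>k. convolution (\<lambda>l. inverse (v l)) (\<lambda>l. inverse (v l)) k \<le> C0 * inverse (v k)"
  shows "solid_matrix_norm v (sup_norm v) {F. finite F \<and> card F \<le> 1}
           (max 1 (max (\<Sum>\<^sub>\<infinity>k. inverse (v k)) C0))"
    (is "solid_matrix_norm v _ ?F ?c")
proof
  note v1 = admissible_weight_ge_1[OF v]
  have v0: "0 < v k" for k using v1[of k] by linarith
  have v0': "0 \<le> v k" for k using v1[of k] by linarith
  define w where "w k = inverse (v k)" for k
  have w0: "0 < w k" for k using v0 by (simp add: w_def)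
  have w1: "w k \<le> 1" for k using v1[of k] by (simp add: w_def inverse_le_1_iff)
  have wsum: "w summable_on UNIV" using sum v0' by (simp add: w_def[abs_def])
  have even: "v (k - l) = v (l - k)" for k l
    using v unfolding admissible_weight_def by (metis minus_diff_eq)
  have row: "row_bounded ?F v A r \<longleftrightarrow> (\<forall>k l. cmod (A k l) * v (k - l) \<le> r)" if "0 \<le> r" for A r
  proof
    assume *: "row_bounded ?F v A r"
    show "\<forall>k l. cmod (A k l) * v (k - l) \<le> r"
    proof (intro allI)
      fix k l
      have "(\<Sum>l\<in>{l}. cmod (A k l) * v (k - l)) \<le> r"
        using * unfolding row_bounded_def by (elim allE[of _ k] ballE[of _ _ "{l}"]) auto
      then show "cmod (A k l) * v (k - l) \<le> r" by simp
    qed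
  next
    assume *: "\<forall>k l. cmod (A k l) * v (k - l) \<le> r"
    show "row_bounded ?F v A r"
      unfolding row_bounded_def
    proof (intro allI ballI)
      fix k F assume F: "F \<in> ?F"
      then have "F = {} \<or> (\<exists>l. F = {l})" by (auto simp: le_Suc_eq card_1_singleton_iff)
      with * that show "(\<Sum>l\<in>F. cmod (A k l) * v (k - l)) \<le> r" by auto
    qed
  qed
  have nonneg: "0 \<le> r" if "row_bounded ?F v A r" for A r
  proof -
    have "(\<Sum>l\<in>{}. cmod (A undefined l) * v (undefined - l)) \<le> r"
      using that unfolding row_bounded_def by (elim allE[of _ undefined] ballE[of _ _ "{}"]) auto
    then show ?thesis by simp
  qed
  have entry: "cmod (A k l) \<le> r * w (k - l)" if "row_bounded ?F v A r" for A r k l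
  proof -
    have "cmod (A k l) * v (k - l) \<le> r" using row[OF nonneg[OF that]] that by blast
    then show ?thesis using v0[of "k - l"] by (simp add: w_def field_simps)
  qed
  show "sup_norm v A \<le> ennreal r \<longleftrightarrow> row_bounded ?F v A r \<and> row_bounded ?F v (mat_transpose A) r"
    if "0 \<le> r" for A r
  proof -
    have "(\<forall>k l. cmod (A l k) * v (k - l) \<le> r) \<longleftrightarrow> (\<forall>k l. cmod (A k l) * v (k - l) \<le> r)"
      by (subst even) blast
    then show ?thesis
      unfolding sup_norm_def SUP_le_iff row[OF that] mat_transpose_def using that by simp
  qed
  show "(\<Sum>l\<in>J. cmod (A k l)) \<le> ?c * a" if A: "row_bounded ?F v A a" and J: "finite J" for A a J k
  proof -
    have "(\<Sum>l\<in>J. cmod (A k l)) \<le> (\<Sum>l\<in>J. a * w (k - l))"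
      by (intro sum_mono entry A)
    also have "\<dots> = a * (\<Sum>l\<in>(\<lambda>l. k - l) ` J. w l)"
      by (subst sum.reindex) (auto simp: inj_on_def sum_distrib_left)
    also have "\<dots> \<le> a * infsum w UNIV"
      using wsum J w0 nonneg[OF A]
      by (intro mult_left_mono finite_sum_le_infsum) (auto intro: less_imp_le)
    also have "\<dots> \<le> a * ?c"
      using nonneg[OF A] by (intro mult_left_mono) (simp_all add: w_def[abs_def])
    finally show ?thesis by (simp add: mult.commute)
  qed
  show "(\<Sum>l\<in>F. (\<Sum>j\<in>J. cmod (A k j) * cmod (B j l)) * v (k - l)) \<le> ?c * a * b"
    if A: "row_bounded ?F v A a" and B: "row_bounded ?F v B b"
      and F: "F \<in> ?F" and J: "finite J" for A a B b F J k
  proof -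
    have ab: "0 \<le> a * b" using nonneg[OF A] nonneg[OF B] by simp
    have single: "(\<Sum>j\<in>J. cmod (A k j) * cmod (B j l)) * v (k - l) \<le> ?c * a * b" for l
    proof -
      have "(\<Sum>j\<in>J. cmod (A k j) * cmod (B j l)) \<le> (\<Sum>j\<in>J. (a * w (k - j)) * (b * w (j - l)))"
        using nonneg[OF A] by (intro sum_mono mult_mono entry A B mult_nonneg_nonneg less_imp_le[OF w0]) auto
      \<comment> \<open>The substitution \<open>i = k - j\<close> exhibits a partial sum of the
        convolution of \<open>w\<close> with itself at \<open>k - l\<close>.\<close>
      also have "\<dots> = a * b * (\<Sum>i\<in>(\<lambda>j. k - j) ` J. w i * w (k - l - i))"
        by (subst sum.reindex) (auto simp: inj_on_def sum_distrib_left mult_ac algebra_simps)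
      also have "\<dots> \<le> a * b * (\<Sum>\<^sub>\<infinity>i. w i * w (k - l - i))"
      proof (intro mult_left_mono ab finite_sum_le_infsum)
        \<comment> \<open>The convolution series converges because
          \<open>w i * w (k - l - i) \<le> w i\<close>.\<close>
        show "(\<lambda>i. w i * w (k - l - i)) summable_on UNIV"
          using w0 w1 by (intro summable_on_comparison_test[OF wsum])
            (auto intro: less_imp_le mult_left_le)
      qed (use J w0 in \<open>auto intro: less_imp_le\<close>)
      also have "\<dots> \<le> a * b * (C0 * w (k - l))"
        using conv[of "k - l"] ab by (intro mult_left_mono) (simp_all add: w_def convolution_def)
      also have "\<dots> \<le> a * b * (?c * w (k - l))"
        using ab w0 by (intro mult_left_mono mult_right_mono) (auto intro: less_imp_le)
      finally have "(\<Sum>j\<in>J. cmod (A k j) * cmod (B j l)) * v (k - l) \<le> a * b * (?c * w (k - l)) * v (k - l)"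
        using v0 by (intro mult_right_mono) (auto intro: less_imp_le)
      also have "\<dots> = ?c * a * b * (w (k - l) * v (k - l))" by (simp only: mult_ac)
      also have "w (k - l) * v (k - l) = 1" using v0[of "k - l"] by (simp add: w_def)
      finally show ?thesis by simp
    qed
    have "F = {} \<or> (\<exists>l. F = {l})" using F by (auto simp: le_Suc_eq card_1_singleton_iff)
    moreover have "0 \<le> ?c * a * b" using nonneg[OF A] nonneg[OF B] by simp
    ultimately show ?thesis using single by auto
  qed
  show "G \<in> ?F" if "F \<in> ?F" "G \<subseteq> F" for F G
    using that card_mono[of F G] finite_subset[of G F] by simp
  show "(\<lambda>l. l + a) ` F \<in> ?F" if "F \<in> ?F" for F a
    using that by (simp add: card_image inj_on_def)
qed (use v in auto)

section \<open>Adjoints, products and entrywise limits in a solid norm\<close>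

context solid_matrix_norm
begin

lemma weight_nonneg: "0 \<le> v k"
  using admissible_weight_ge_1[OF weight, of k] by simp

lemma row_bounded_nonneg:
  assumes "row_bounded \<F> v A r"
  shows "0 \<le> r"
proof -
  have "(\<Sum>l\<in>{}. cmod (A undefined l) * v (undefined - l)) \<le> r"
    using assms empty_in unfolding row_bounded_def by blast
  then show ?thesis by simp
qed

lemma row_bounded_dominated:
  assumes "row_bounded \<F> v A r" "\<And>k l. cmod (B k l) \<le> cmod (A k l)"
  shows "row_bounded \<F> v B r"
  using assms unfolding row_bounded_def
  by (meson mult_right_mono order_trans sum_mono weight_nonneg)

lemma mat_spaceE:
  assumes "A \<in> mat_space N"
  obtains r where "0 \<le> r" "N A \<le> ennreal r"
proof -
  have "N A < \<infinity>" using assms by (simp add: mat_space_def)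
  then show ?thesis using that by (cases "N A") auto
qed

lemma mat_spaceI: "N A \<le> ennreal r \<Longrightarrow> A \<in> mat_space N"
  by (auto simp: mat_space_def intro: le_less_trans)

text \<open>Solidity: the row and column bounds are monotone in the moduli of the entries. Finite
  sections, which only delete entries, are controlled in this way.\<close>

lemma N_dominated:
  assumes "0 \<le> r" "N A \<le> ennreal r" "\<And>k l. cmod (B k l) \<le> cmod (A k l)"
  shows "N B \<le> ennreal r"
  using assms row_bounded_dominated[of A r B]
    row_bounded_dominated[of "mat_transpose A" r "mat_transpose B"]
  by (simp add: N_le_iff mat_transpose_def)

lemma N_finite_section: "0 \<le> r \<Longrightarrow> N A \<le> ennreal r \<Longrightarrow> N (finite_section A n) \<le> ennreal r"
  by (erule N_dominated) (auto simp: finite_section_def indicator_def)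

lemma N_adjoint:
  assumes "0 \<le> r" "N A \<le> ennreal r"
  shows "N (mat_adjoint A) \<le> ennreal r"
  using assms row_bounded_dominated[of A r "mat_transpose (mat_adjoint A)"]
    row_bounded_dominated[of "mat_transpose A" r "mat_adjoint A"]
  by (simp add: N_le_iff mat_transpose_def mat_adjoint_def)

lemma row_bounded_entry:
  assumes "row_bounded \<F> v A a"
  shows "cmod (A k l) \<le> c * a"
  using row_sum_le[OF assms, of "{l}"] by simp

text \<open>Rows act boundedly on bounded sequences, with constant \<open>c * a\<close>. The index
  set \<open>X\<close> is kept general so that the tail outside a cube can be estimated too.\<close>

lemma row_bounded_abs_summable:
  assumes A: "row_bounded \<F> v A a" and x: "\<And>l. l \<in> X \<Longrightarrow> cmod (x l) \<le> e" and e: "0 \<le> e"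
  shows "(\<lambda>l. cmod (A k l * x l)) summable_on X"
    and "(\<Sum>\<^sub>\<infinity>l\<in>X. cmod (A k l * x l)) \<le> c * a * e"
proof -
  have fin: "(\<Sum>l\<in>J. cmod (A k l * x l)) \<le> c * a * e" if "finite J" "J \<subseteq> X" for J
  proof -
    have "(\<Sum>l\<in>J. cmod (A k l * x l)) \<le> (\<Sum>l\<in>J. cmod (A k l) * e)"
      using x that by (intro sum_mono) (auto simp: norm_mult intro!: mult_left_mono)
    also have "\<dots> = (\<Sum>l\<in>J. cmod (A k l)) * e" by (simp add: sum_distrib_right)
    also have "\<dots> \<le> c * a * e" by (intro mult_right_mono row_sum_le A that e)
    finally show ?thesis .
  qed
  then show "(\<lambda>l. cmod (A k l * x l)) summable_on X"
    by (intro nonneg_bdd_above_summable_on bdd_aboveI[of _ "c * a * e"]) auto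
  then show "(\<Sum>\<^sub>\<infinity>l\<in>X. cmod (A k l * x l)) \<le> c * a * e"
    using fin by (intro infsum_le_finite_sums) auto
qed

text \<open>The axiom \<open>row_mult_le\<close> bounds the partial products over finite
  \<open>J\<close>. As \<open>F\<close> is finite, the bound survives the limit along all finite
  \<open>J\<close>.\<close>

lemma row_bounded_mult:
  assumes A: "row_bounded \<F> v A a" and B: "row_bounded \<F> v B b"
  shows "row_bounded \<F> v (mat_mult A B) (c * a * b)"
  unfolding row_bounded_def
proof (intro allI ballI)
  fix k F assume F: "F \<in> \<F>"
  have b: "0 \<le> c * b" using row_bounded_nonneg[OF B] const_ge_1 by simp
  note sm = row_bounded_abs_summable[OF A row_bounded_entry[OF B] b]
  have "(\<Sum>l\<in>F. cmod (mat_mult A B k l) * v (k - l))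
      \<le> (\<Sum>l\<in>F. (\<Sum>\<^sub>\<infinity>j. cmod (A k j * B j l)) * v (k - l))"
    unfolding mat_mult_def
    by (intro sum_mono mult_right_mono weight_nonneg norm_infsum_bound sm)
  also have "\<dots> \<le> c * a * b"
  proof (rule tendsto_upperbound)
    show "((\<lambda>J. \<Sum>l\<in>F. (\<Sum>j\<in>J. cmod (A k j * B j l)) * v (k - l)) \<longlongrightarrow>
        (\<Sum>l\<in>F. (\<Sum>\<^sub>\<infinity>j. cmod (A k j * B j l)) * v (k - l))) (finite_subsets_at_top UNIV)"
      by (intro tendsto_intros infsum_tendsto sm)
    show "\<forall>\<^sub>F J in finite_subsets_at_top UNIV.
        (\<Sum>l\<in>F. (\<Sum>j\<in>J. cmod (A k j * B j l)) * v (k - l)) \<le> c * a * b"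
      using row_mult_le[OF A B F]
      by (intro eventually_finite_subsets_at_top_weakI) (simp add: norm_mult)
  qed simp
  finally show "(\<Sum>l\<in>F. cmod (mat_mult A B k l) * v (k - l)) \<le> c * a * b" .
qed

text \<open>The column bound is the row bound of the transposed product, in which the factors change
  places.\<close>

lemma N_mult:
  assumes "0 \<le> a" "N A \<le> ennreal a" "0 \<le> b" "N B \<le> ennreal b"
  shows "N (mat_mult A B) \<le> ennreal (c * a * b)"
proof -
  have "0 \<le> c * a * b" using assms const_ge_1 by simp
  moreover have "row_bounded \<F> v (mat_transpose (mat_mult A B)) (c * a * b)"
    using row_bounded_mult[of "mat_transpose B" b "mat_transpose A" a] assms
    by (simp add: mat_transpose_mult N_le_iff mult_ac)
  ultimately show ?thesis
    using row_bounded_mult assms by (simp add: N_le_iff)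
qed

text \<open>Each instance of the bound involves finitely many entries, so entrywise convergence
  preserves it.\<close>

lemma row_bounded_limit:
  assumes lim: "\<And>k l. (\<lambda>n. G n k l) \<longlonglongrightarrow> A k l" and bnd: "\<And>n. row_bounded \<F> v (G n) r"
  shows "row_bounded \<F> v A r"
  unfolding row_bounded_def
proof (intro allI ballI)
  fix k F assume F: "F \<in> \<F>"
  have "(\<lambda>n. \<Sum>l\<in>F. cmod (G n k l) * v (k - l)) \<longlonglongrightarrow> (\<Sum>l\<in>F. cmod (A k l) * v (k - l))"
    by (intro tendsto_intros lim)
  then show "(\<Sum>l\<in>F. cmod (A k l) * v (k - l)) \<le> r"
    by (rule LIMSEQ_le_const2) (use bnd F in \<open>auto simp: row_bounded_def\<close>)
qed

lemma N_limit:
  assumes "\<And>k l. (\<lambda>n. G n k l) \<longlonglongrightarrow> A k l" "\<And>n. N (G n) \<le> ennreal r" "0 \<le> r"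
  shows "N A \<le> ennreal r"
  using assms row_bounded_limit[of G A r] row_bounded_limit[of "\<lambda>n. mat_transpose (G n)" "mat_transpose A" r]
  by (simp add: N_le_iff mat_transpose_def)

end

subsection \<open>Assembling a sequence of finite matrices into a block diagonal matrix\<close>

lemma finite_cube: "finite (cube n :: (int ^ 'd::finite) set)"
proof -
  have "inj_on vec_nth (cube n :: (int ^ 'd) set)" by (auto simp: inj_on_def vec_nth_inject)
  moreover have "vec_nth ` (cube n :: (int ^ 'd) set) \<subseteq> PiE UNIV (\<lambda>_. {- int n..int n})"
    by (auto simp: cube_def abs_le_iff) (smt (verit))
  then have "finite (vec_nth ` (cube n :: (int ^ 'd) set))"
    by (rule finite_subset) (intro finite_PiE; simp)
  ultimately show ?thesis by (rule finite_imageD[rotated])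
qed

definition block_centre :: "nat \<Rightarrow> int ^ 'd::finite" where
  "block_centre n = (\<chi> i. int (n\<^sup>2 + n))"

text \<open>The \<open>n\<close>-th block is the cube with sides \<open>{n\<^sup>2..n\<^sup>2 + 2 * n}\<close>. These intervals partition
  \<open>\<nat>\<close>, so the blocks are disjoint.\<close>

lemma block_unique:
  fixes k :: "int ^ 'd::finite"
  assumes "k - block_centre m \<in> cube m" "k - block_centre n \<in> cube n"
  shows "m = n"
proof -
  \<comment> \<open>This only names a coordinate; any single one already determines the
    block.\<close>
  obtain i :: 'd where True by simp
  have m: "int (m\<^sup>2) \<le> k $ i" "k $ i < int ((Suc m)\<^sup>2)"
    using assms(1) by (auto simp: cube_def block_centre_def abs_le_iff power2_eq_square dest!: spec[of _ i])
  have n: "int (n\<^sup>2) \<le> k $ i" "k $ i < int ((Suc n)\<^sup>2)"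
    using assms(2) by (auto simp: cube_def block_centre_def abs_le_iff power2_eq_square dest!: spec[of _ i])
  have "m\<^sup>2 < (Suc n)\<^sup>2" "n\<^sup>2 < (Suc m)\<^sup>2" using m n by linarith+
  then have "m < Suc n" "n < Suc m" by (auto dest: power_less_imp_less_base)
  then show ?thesis by simp
qed

text \<open>The fibres of this labelling are the diagonal blocks: \<open>Inl n\<close> for the
  \<open>n\<close>-th cube, and \<open>Inr k\<close> for an index outside all cubes, which forms a
  block of its own.\<close>

definition block_label :: "int ^ 'd::finite \<Rightarrow> nat + int ^ 'd" where
  "block_label k = (if \<exists>n. k - block_centre n \<in> cube n
     then Inl (THE n. k - block_centre n \<in> cube n) else Inr k)"

lemma block_label_Inl: "block_label k = Inl n \<longleftrightarrow> k - block_centre n \<in> cube n"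
proof -
  have "(THE n. k - block_centre n \<in> cube n) = m" if "k - block_centre m \<in> cube m" for m
    using that block_unique by blast
  then show ?thesis unfolding block_label_def by auto
qed

lemma block_label_Inr: "block_label k = Inr j \<Longrightarrow> k = j"
  by (auto simp: block_label_def split: if_splits)

lemma block_fibre_Inl: "block_label -` {Inl n} = (\<lambda>k. k + block_centre n) ` cube n"
proof -
  have "k \<in> (\<lambda>k. k + block_centre n) ` cube n" if "k - block_centre n \<in> cube n" for k
    using that by (intro image_eqI[of _ _ "k - block_centre n"]) auto
  then show ?thesis by (auto simp: block_label_Inl)
qed

lemma finite_block_fibre: "finite (block_label -` {j :: nat + int ^ 'd::finite})"
proof (cases j)
  case (Inl n)
  then show ?thesis by (simp add: block_fibre_Inl finite_cube)
next
  case (Inr k)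
  then have "block_label -` {j} \<subseteq> {k}" by (auto dest: block_label_Inr)
  then show ?thesis using finite_subset by blast
qed

text \<open>Identity entries outside all blocks keep the matrix invertible.\<close>

definition block_mat :: "(nat \<Rightarrow> (int ^ 'd::finite) cmat) \<Rightarrow> (int ^ 'd) cmat" where
  "block_mat B k l = (case block_label k of
     Inl n \<Rightarrow> if block_label l = Inl n then B n (k - block_centre n) (l - block_centre n) else 0
   | Inr _ \<Rightarrow> of_bool (k = l))"

lemma block_mat_off: "block_label k \<noteq> block_label l \<Longrightarrow> block_mat B k l = 0"
  by (auto simp: block_mat_def split: sum.split)

lemma block_mat_Inl:
  "block_label k = Inl n \<Longrightarrow> block_label l = Inl n \<Longrightarrow>
    block_mat B k l = B n (k - block_centre n) (l - block_centre n)"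
  by (simp add: block_mat_def)

lemma block_mat_Inr: "block_label k = Inr j \<Longrightarrow> block_mat B k l = of_bool (k = l)"
  by (simp add: block_mat_def)

lemma block_mat_transpose: "mat_transpose (block_mat B) = block_mat (\<lambda>n. mat_transpose (B n))"
proof (intro ext)
  fix k l
  show "mat_transpose (block_mat B) k l = block_mat (\<lambda>n. mat_transpose (B n)) k l"
    by (cases "block_label k"; cases "block_label l")
      (auto simp: mat_transpose_def block_mat_def)
qed

lemma sum_block_fibre_Inl:
  fixes h :: "int ^ 'd::finite \<Rightarrow> 'b::comm_monoid_add"
  shows "(\<Sum>l\<in>block_label -` {Inl n}. h l) = (\<Sum>l\<in>cube n. h (l + block_centre n))"
  unfolding block_fibre_Inl by (subst sum.reindex) (auto simp: inj_on_def)

text \<open>Inside a cube this is the identity for \<open>B n\<close> and \<open>B' n\<close> up to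
  a translation of the indices; outside the cubes the fibre is a single identity entry.\<close>

lemma sum_block_mat_inverse:
  fixes B B' :: "nat \<Rightarrow> (int ^ 'd::finite) cmat"
  assumes inv: "\<And>n k l. k \<in> cube n \<Longrightarrow> l \<in> cube n \<Longrightarrow>
      (\<Sum>j\<in>cube n. B n k j * B' n j l) = of_bool (k = l)"
    and eq: "block_label k = block_label l"
  shows "(\<Sum>m\<in>block_label -` {block_label k}. block_mat B k m * block_mat B' m l) = of_bool (k = l)"
proof (cases "block_label k")
  case (Inl n)
  have "(\<Sum>m\<in>block_label -` {Inl n}. block_mat B k m * block_mat B' m l)
      = (\<Sum>m\<in>block_label -` {Inl n}. B n (k - block_centre n) (m - block_centre n) *
          B' n (m - block_centre n) (l - block_centre n))"
    using Inl eq by (intro sum.cong) (auto simp: block_mat_Inl)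
  also have "\<dots> = of_bool (k - block_centre n = l - block_centre n)"
    unfolding sum_block_fibre_Inl using Inl eq by (simp add: block_label_Inl[symmetric] inv)
  finally show ?thesis using Inl by simp
next
  case (Inr j)
  then have "block_label -` {block_label k} = {k}" "l = k"
    using eq by (auto dest: block_label_Inr)
  then show ?thesis using Inr by (simp add: block_mat_Inr)
qed

text \<open>The operator norm is a supremum over the unit ball, so it is applied to the part of
  \<open>x\<close> in the cube divided by its norm \<open>s\<close>. If \<open>s = 0\<close>, then
  \<open>x\<close> vanishes on the cube.\<close>

lemma op_norm_cube_bound:
  assumes B: "B \<in> cube_mats n" and bnd: "op_norm B \<le> ennreal C" and C: "0 \<le> C"
  shows "L2_set (\<lambda>k. cmod (\<Sum>l\<in>cube n. B k l * x l)) (cube n) \<le> C * L2_set (\<lambda>k. cmod (x k)) (cube n)"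
proof -
  define s where "s = L2_set (\<lambda>k. cmod (x k)) (cube n)"
  show ?thesis
  proof (cases "s = 0")
    case True
    then have "\<forall>k\<in>cube n. x k = 0"
      unfolding s_def by (subst (asm) L2_set_eq_0_iff) (auto simp: finite_cube)
    then show ?thesis by (simp add: L2_set_0')
  next
    case False
    then have s: "0 < s" unfolding s_def by (simp add: less_le)
    define y where "y k = (if k \<in> cube n then x k / s else 0)" for k
    have "L2_set (\<lambda>k. cmod (y k)) (cube n) = L2_set (\<lambda>k. inverse s * cmod (x k)) (cube n)"
      by (rule L2_set_cong) (use s in \<open>auto simp: y_def norm_divide field_simps\<close>)
    also have "\<dots> = inverse s * s"
      unfolding s_def by (rule L2_set_right_distrib[symmetric]) (use s in \<open>simp add: s_def\<close>)
    finally have "L2_set (\<lambda>k. cmod (y k)) (cube n) = 1" using s by simp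
    moreover have "y k = 0" if "k \<notin> cube n" for k using that by (simp add: y_def)
    ultimately have y: "y \<in> ell2" "ell2_norm y \<le> 1"
      using ell2_finite_support[OF finite_cube, of n y] by auto
    have "ennreal (ell2_norm (op_of_mat B y)) \<le> op_norm B"
      unfolding op_norm_def using y by (intro SUP_upper) auto
    then have le: "ell2_norm (op_of_mat B y) \<le> C" using bnd C by (metis ennreal_le_iff order_trans)
    have op: "op_of_mat B y k = (\<Sum>l\<in>cube n. B k l * y l)" for k
      using B by (intro op_of_mat_finite_row finite_cube) (auto simp: cube_mats_def)
    have "op_of_mat B y k = 0" if "k \<notin> cube n" for k
      using B that by (simp add: op cube_mats_def)
    then have "L2_set (\<lambda>k. cmod (op_of_mat B y k)) (cube n) \<le> C"
      using le ell2_finite_support(2)[OF finite_cube, of n "op_of_mat B y"] by simp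
    moreover have "cmod (op_of_mat B y k) = inverse s * cmod (\<Sum>l\<in>cube n. B k l * x l)" for k
    proof -
      have "op_of_mat B y k = (\<Sum>l\<in>cube n. B k l * x l) / s"
        unfolding op sum_divide_distrib by (intro sum.cong) (auto simp: y_def)
      then have "cmod (op_of_mat B y k) = cmod (\<Sum>l\<in>cube n. B k l * x l) / s"
        using s by (simp add: norm_divide)
      then show ?thesis by (simp add: divide_inverse_commute)
    qed
    ultimately have "inverse s * L2_set (\<lambda>k. cmod (\<Sum>l\<in>cube n. B k l * x l)) (cube n) \<le> C"
      using s by (simp add: L2_set_right_distrib)
    then show ?thesis using s unfolding s_def[symmetric] by (simp add: field_simps)
  qed
qed

section \<open>Norms of block matrices and inverse-closedness of bounded sequences\<close>

context solid_matrix_norm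
begin

text \<open>The weight depends on index differences only, so moving a block leaves its weighted row
  sums unchanged. The identity rows contribute \<open>v 0 = 1\<close>, hence
  \<open>1 \<le> r\<close>.\<close>

lemma row_bounded_block_mat:
  assumes bnd: "\<And>n. row_bounded \<F> v (B n) r" and r: "1 \<le> r"
  shows "row_bounded \<F> v (block_mat B) r"
  unfolding row_bounded_def
proof (intro allI ballI)
  fix k F assume F: "F \<in> \<F>"
  show "(\<Sum>l\<in>F. cmod (block_mat B k l) * v (k - l)) \<le> r"
  proof (cases "block_label k")
    case (Inl n)
    define G where "G = F \<inter> block_label -` {Inl n}"
    have G: "G \<in> \<F>" using subset_in[OF F] by (simp add: G_def)
    let ?p = "block_centre n"
    have "(\<Sum>l\<in>F. cmod (block_mat B k l) * v (k - l)) = (\<Sum>l\<in>G. cmod (block_mat B k l) * v (k - l))"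
      using finite_in[OF F] Inl unfolding G_def
      by (intro sum.mono_neutral_right) (auto, metis block_mat_off)
    also have "\<dots> = (\<Sum>l\<in>G. cmod (B n (k - ?p) (l - ?p)) * v (k - ?p - (l - ?p)))"
      using Inl by (intro sum.cong) (auto simp: G_def block_mat_Inl)
    also have "\<dots> = (\<Sum>l\<in>(\<lambda>l. l + (- ?p)) ` G. cmod (B n (k - ?p) l) * v (k - ?p - l))"
      by (subst sum.reindex) (auto simp: inj_on_def)
    also have "\<dots> \<le> r"
      using bnd translate_in[OF G] unfolding row_bounded_def by blast
    finally show ?thesis .
  next
    case (Inr j)
    have "(\<Sum>l\<in>F. cmod (block_mat B k l) * v (k - l)) = (\<Sum>l\<in>F \<inter> {k}. cmod (block_mat B k l) * v (k - l))"
      using finite_in[OF F] Inr by (intro sum.mono_neutral_right) (auto simp: block_mat_Inr)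
    also have "\<dots> \<le> (\<Sum>l\<in>{k}. cmod (block_mat B k l) * v (k - l))"
      by (intro sum_mono2) (auto simp: weight_nonneg)
    also have "\<dots> = v 0" using Inr by (simp add: block_mat_Inr)
    finally show ?thesis using weight r by (simp add: admissible_weight_def)
  qed
qed

text \<open>Every row of \<open>B n\<close> inside the cube reappears, translated, as part of a row
  of \<open>block_mat B\<close>; the other rows vanish.\<close>

lemma row_bounded_block:
  assumes B: "B n \<in> cube_mats n" and bnd: "row_bounded \<F> v (block_mat B) r"
  shows "row_bounded \<F> v (B n) r"
  unfolding row_bounded_def
proof (intro allI ballI)
  fix k F assume F: "F \<in> \<F>"
  show "(\<Sum>l\<in>F. cmod (B n k l) * v (k - l)) \<le> r"
  proof (cases "k \<in> cube n")
    case False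
    then show ?thesis using B row_bounded_nonneg[OF bnd] by (simp add: cube_mats_def)
  next
    case True
    let ?p = "block_centre n"
    define G where "G = F \<inter> cube n"
    have "G \<in> \<F>" using subset_in[OF F] by (simp add: G_def)
    have "(\<Sum>l\<in>F. cmod (B n k l) * v (k - l)) = (\<Sum>l\<in>G. cmod (B n k l) * v (k - l))"
      using finite_in[OF F] B unfolding G_def
      by (intro sum.mono_neutral_right) (auto simp: cube_mats_def)
    also have "\<dots> = (\<Sum>l\<in>G. cmod (block_mat B (k + ?p) (l + ?p)) * v (k + ?p - (l + ?p)))"
    proof (intro sum.cong refl)
      fix l assume "l \<in> G"
      then have "block_label (k + ?p) = Inl n" "block_label (l + ?p) = Inl n"
        using True by (auto simp: block_label_Inl G_def)
      then show "cmod (B n k l) * v (k - l)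
          = cmod (block_mat B (k + ?p) (l + ?p)) * v (k + ?p - (l + ?p))"
        by (simp add: block_mat_Inl)
    qed
    also have "\<dots> = (\<Sum>l\<in>(\<lambda>l. l + ?p) ` G. cmod (block_mat B (k + ?p) l) * v (k + ?p - l))"
      by (subst sum.reindex) (auto simp: inj_on_def)
    also have "\<dots> \<le> r"
      using bnd translate_in[OF \<open>G \<in> \<F>\<close>] unfolding row_bounded_def by blast
    finally show ?thesis .
  qed
qed

lemma inverse_closed_imp_F_inverse_closed:
  assumes "inverse_closed N"
  shows "seq_inverse_closed N (F_seqs N)"
  unfolding seq_inverse_closed_def
proof (intro ballI allI impI, elim conjE)
  fix A B :: "nat \<Rightarrow> (int ^ 'd) cmat" and C :: real
  assume "A \<in> F_seqs N" and inv: "\<forall>n. cube_inverse n (A n) (B n)"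
    and NA: "\<forall>n. N (A n) \<le> ennreal C" and opB: "\<forall>n. op_norm (B n) \<le> ennreal C"
  \<comment> \<open>At least 1, to accommodate the identity entries of the block matrices.\<close>
  define K where "K = max C 1"
  have K: "0 \<le> K" "1 \<le> K" by (auto simp: K_def)
  have CK: "ennreal C \<le> ennreal K" by (simp add: K_def ennreal_leI)
  have B: "B n \<in> cube_mats n" for n using inv by (simp add: cube_inverse_def)
  have bndA: "row_bounded \<F> v (A n) K" "row_bounded \<F> v (mat_transpose (A n)) K" for n
    using NA CK N_le_iff[OF K(1)] by (meson order_trans)+
  have rows: "row_bounded \<F> v (block_mat A) K"
    and cols: "row_bounded \<F> v (mat_transpose (block_mat A)) K"
    unfolding block_mat_transpose using bndA K by (auto intro: row_bounded_block_mat)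
  then have "block_mat A \<in> mat_space N"
    by (intro mat_spaceI[of _ K]) (simp add: N_le_iff K)
  moreover have "ell2_inverse (block_mat A) (op_of_mat (block_mat B))"
    unfolding ell2_inverse_def
  proof (intro conjI ballI)
    \<comment> \<open>The Schur test applies on each block, since all absolute row and column sums
      are at most \<open>c * K\<close>.\<close>
    show "ell2_bounded_op (op_of_mat (block_mat A))"
    proof (rule ell2_bounded_op_fibrewise[OF finite_block_fibre block_mat_off])
      fix j and x :: "int ^ 'd \<Rightarrow> complex"
      show "L2_set (\<lambda>k. cmod (\<Sum>l\<in>block_label -` {j}. block_mat A k l * x l)) (block_label -` {j})
          \<le> c * K * L2_set (\<lambda>k. cmod (x k)) (block_label -` {j})"
        using row_sum_le[OF rows finite_block_fibre] row_sum_le[OF cols finite_block_fibre] K const_ge_1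
        by (intro finite_schur_test finite_block_fibre) (auto simp: mat_transpose_def)
    qed (use K const_ge_1 in auto)
    \<comment> \<open>For the inverses only the operator norms are controlled at this point, so the
      blocks are bounded through these.\<close>
    show "ell2_bounded_op (op_of_mat (block_mat B))"
    proof (rule ell2_bounded_op_fibrewise[OF finite_block_fibre block_mat_off])
      fix j and x :: "int ^ 'd \<Rightarrow> complex"
      show "L2_set (\<lambda>k. cmod (\<Sum>l\<in>block_label -` {j}. block_mat B k l * x l)) (block_label -` {j})
          \<le> K * L2_set (\<lambda>k. cmod (x k)) (block_label -` {j})"
      proof (cases j)
        case (Inl n)
        let ?p = "block_centre n :: int ^ 'd"
        have label: "block_label (k + ?p) = Inl n" if "k \<in> cube n" for k
          using that by (simp add: block_label_Inl)
        have "op_norm (B n) \<le> ennreal K" using opB CK by (meson order_trans)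
        then have "L2_set (\<lambda>k. cmod (\<Sum>l\<in>cube n. B n k l * x (l + ?p))) (cube n)
            \<le> K * L2_set (\<lambda>k. cmod (x (k + ?p))) (cube n)"
          by (intro op_norm_cube_bound B K)
        then show ?thesis
          unfolding L2_set_def Inl sum_block_fibre_Inl by (simp add: block_mat_Inl label)
      next
        case (Inr k)
        then have "block_label -` {j} \<subseteq> {k}" by (auto dest: block_label_Inr)
        \<comment> \<open>The fibre is empty when \<open>k\<close> lies in one of the cubes.\<close>
        then consider "block_label -` {j} = {}" | "block_label -` {j} = {k}" by blast
        then show ?thesis
        proof cases
          case 2
          then have "block_label k = Inr k" using Inr by auto
          with 2 K show ?thesis by (simp add: block_mat_Inr mult_le_cancel_right1)
        qed simp
      qed
    qed (use K in auto)
  next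
    fix x :: "int ^ 'd \<Rightarrow> complex"
    have "(\<Sum>j\<in>cube n. B n k j * A n j l) = of_bool (k = l)"
      "(\<Sum>j\<in>cube n. A n k j * B n j l) = of_bool (k = l)" if "k \<in> cube n" "l \<in> cube n" for n k l
      using inv that by (auto simp: cube_inverse_def)
    note inverses = sum_block_mat_inverse[of B A, OF this(1)] sum_block_mat_inverse[of A B, OF this(2)]
    show "op_of_mat (block_mat B) (op_of_mat (block_mat A) x) = x"
      by (rule fibrewise_left_inverse[OF finite_block_fibre block_mat_off block_mat_off inverses(1)])
    show "op_of_mat (block_mat A) (op_of_mat (block_mat B) x) = x"
      by (rule fibrewise_left_inverse[OF finite_block_fibre block_mat_off block_mat_off inverses(2)])
  qed
  ultimately have "mat_of_op (op_of_mat (block_mat B)) \<in> mat_space N"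
    using assms unfolding inverse_closed_def by blast
  then have "block_mat B \<in> mat_space N" by (simp add: mat_of_op_of_mat)
  then obtain r where r: "0 \<le> r" "N (block_mat B) \<le> ennreal r" by (rule mat_spaceE)
  have "N (B n) \<le> ennreal r" for n
  proof -
    have "mat_transpose (B n) \<in> cube_mats n" using B[of n] by (auto simp: cube_mats_def mat_transpose_def)
    then show ?thesis
      using r row_bounded_block[of B n r] row_bounded_block[of "\<lambda>n. mat_transpose (B n)" n r] B
      by (simp add: N_le_iff block_mat_transpose)
  qed
  then show "\<exists>C'. \<forall>n. N (B n) \<le> ennreal C'" by blast
qed

text \<open>Deleting entries does not increase a solid norm, so the finite sections of one matrix
  form a bounded sequence of cube matrices.\<close>

lemma F_inverse_closed_imp_FS_inverse_closed:
  assumes "seq_inverse_closed N (F_seqs N)"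
  shows "seq_inverse_closed N (FS_seqs N)"
proof -
  have "FS_seqs N \<subseteq> F_seqs N"
  proof
    fix S assume "S \<in> FS_seqs N"
    then obtain A where A: "A \<in> mat_space N" "S = finite_section A" by (auto simp: FS_seqs_def)
    from A(1) obtain r where "0 \<le> r" "N A \<le> ennreal r" by (rule mat_spaceE)
    then have "(SUP n. N (S n)) \<le> ennreal r"
      unfolding A(2) by (intro SUP_least N_finite_section)
    then have "(SUP n. N (S n)) < \<infinity>" by (auto intro: le_less_trans)
    then show "S \<in> F_seqs N" by (auto simp: F_seqs_def A(2) cube_mats_def finite_section_def)
  qed
  then show ?thesis using assms unfolding seq_inverse_closed_def by blast
qed

end

subsection \<open>The Gram matrix and its finite sections\<close>

lemma finite_subset_cube:
  fixes F :: "(int ^ 'd::finite) set"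
  assumes "finite F"
  obtains m where "\<And>n. m \<le> n \<Longrightarrow> F \<subseteq> cube n"
proof -
  define m where "m = (\<Sum>k\<in>F. \<Sum>i\<in>UNIV. nat \<bar>k $ i\<bar>)"
  have "\<bar>k $ i\<bar> \<le> int m" if "k \<in> F" for k i
  proof -
    have "nat \<bar>k $ i\<bar> \<le> (\<Sum>i\<in>UNIV. nat \<bar>k $ i\<bar>)" by (rule member_le_sum) auto
    also have "\<dots> \<le> m" unfolding m_def using that assms by (intro member_le_sum) auto
    finally show ?thesis by simp
  qed
  then have "F \<subseteq> cube n" if "m \<le> n" for n
    unfolding cube_def using that by (auto intro: order_trans[of _ "int m"])
  then show ?thesis by (rule that)
qed

lemma has_sum_finite_sum:
  fixes f :: "'k \<Rightarrow> 'i \<Rightarrow> 'b::topological_comm_monoid_add"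
  assumes "\<And>k. k \<in> C \<Longrightarrow> (f k has_sum s k) X"
  shows "((\<lambda>i. \<Sum>k\<in>C. f k i) has_sum (\<Sum>k\<in>C. s k)) X"
  using assms by (induction C rule: infinite_finite_induct) (auto intro: has_sum_add)

lemma Cauchy_Schwarz_cnj_sum:
  "cmod (\<Sum>k\<in>C. cnj (x k) * z k) \<le> L2_set (\<lambda>k. cmod (x k)) C * L2_set (\<lambda>k. cmod (z k)) C"
proof -
  have "cmod (\<Sum>k\<in>C. cnj (x k) * z k) \<le> (\<Sum>k\<in>C. \<bar>cmod (x k)\<bar> * \<bar>cmod (z k)\<bar>)"
    by (rule order_trans[OF norm_sum]) (simp add: norm_mult)
  also have "\<dots> \<le> L2_set (\<lambda>k. cmod (x k)) C * L2_set (\<lambda>k. cmod (z k)) C"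
    by (rule L2_set_mult_ineq)
  finally show ?thesis .
qed

section \<open>Lower bounds for the Gram matrix and its factorisation as an operator\<close>

context solid_matrix_norm
begin

text \<open>Expanding the squared modulus of each entry of A x over the finite set \<open>C\<close>
  and summing over the entries produces the Gram matrix. The square-summability of A x comes out of
  the same computation.\<close>

lemma gram_quadratic_form:
  assumes cols: "row_bounded \<F> v (mat_transpose A) a"
    and C: "finite C" and x: "\<And>l. l \<notin> C \<Longrightarrow> x l = 0"
  shows "(\<Sum>k\<in>C. cnj (x k) * (\<Sum>l\<in>C. mat_mult (mat_adjoint A) A k l * x l))
       = of_real (\<Sum>\<^sub>\<infinity>i. (cmod (op_of_mat A x i))\<^sup>2)"
proof -
  define z where "z = (\<Sum>k\<in>C. cnj (x k) * (\<Sum>l\<in>C. mat_mult (mat_adjoint A) A k l * x l))"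
  have adj: "row_bounded \<F> v (mat_adjoint A) a"
    by (rule row_bounded_dominated[OF cols]) (simp add: mat_transpose_def mat_adjoint_def)
  have a: "0 \<le> c * a" using row_bounded_nonneg[OF cols] const_ge_1 by simp
  have entry: "cmod (A i l) \<le> c * a" for i l
    using row_bounded_entry[OF cols, of l i] by (simp add: mat_transpose_def)
  have "(\<lambda>i. mat_adjoint A k i * A i l) summable_on UNIV" for k l
    by (rule abs_summable_summable, rule row_bounded_abs_summable(1)[OF adj entry a])
  then have hs: "((\<lambda>i. cnj (A i k) * A i l) has_sum mat_mult (mat_adjoint A) A k l) UNIV" for k l
    unfolding mat_mult_def mat_adjoint_def by (rule has_sum_infsum)
  have "((\<lambda>i. \<Sum>k\<in>C. \<Sum>l\<in>C. cnj (x k) * (cnj (A i k) * A i l * x l)) has_sum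
      (\<Sum>k\<in>C. \<Sum>l\<in>C. cnj (x k) * (mat_mult (mat_adjoint A) A k l * x l))) UNIV"
    by (intro has_sum_finite_sum has_sum_cmult_right has_sum_cmult_left hs)
  moreover have "(\<Sum>k\<in>C. \<Sum>l\<in>C. cnj (x k) * (cnj (A i k) * A i l * x l))
      = of_real ((cmod (op_of_mat A x i))\<^sup>2)" for i
  proof -
    have "op_of_mat A x i = (\<Sum>l\<in>C. A i l * x l)"
      unfolding op_of_mat_def by (intro infsumI has_sum_finite_neutralI) (auto simp: C x)
    then have "of_real ((cmod (op_of_mat A x i))\<^sup>2) = (\<Sum>k\<in>C. cnj (A i k * x k)) * (\<Sum>l\<in>C. A i l * x l)"
      by (simp add: complex_norm_square mult.commute del: of_real_power)
    also have "\<dots> = (\<Sum>k\<in>C. \<Sum>l\<in>C. cnj (x k) * (cnj (A i k) * A i l * x l))"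
      unfolding sum_product by (intro sum.cong refl) (simp add: mult_ac)
    finally show ?thesis by simp
  qed
  ultimately have "((\<lambda>i. complex_of_real ((cmod (op_of_mat A x i))\<^sup>2)) has_sum
      (\<Sum>k\<in>C. cnj (x k) * (\<Sum>l\<in>C. mat_mult (mat_adjoint A) A k l * x l))) UNIV"
    by (simp add: sum_distrib_left)
  then have H: "((\<lambda>i. complex_of_real ((cmod (op_of_mat A x i))\<^sup>2)) has_sum z) UNIV"
    by (simp only: z_def)
  \<comment> \<open>Real parts show that the real series converges, so that its
    \<open>infsum\<close> is a genuine sum and not a default value.\<close>
  have "((\<lambda>i. (cmod (op_of_mat A x i))\<^sup>2) has_sum Re z) UNIV"
    using has_sum_Re[OF H] by simp
  then have "((\<lambda>i. complex_of_real ((cmod (op_of_mat A x i))\<^sup>2)) has_sum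
      of_real (\<Sum>\<^sub>\<infinity>i. (cmod (op_of_mat A x i))\<^sup>2)) UNIV"
    using has_sum_of_real infsumI by metis
  with H show ?thesis unfolding z_def by (rule has_sum_unique)
qed

text \<open>Let y be the truncation of \<open>x\<close> to \<open>C\<close> and M the Gram matrix.
  Then |y|^2 <= K^2 |A y|^2 = K^2 <M y, y> <= K^2 |y| t by Cauchy-Schwarz, where t is the norm of M
  y on \<open>C\<close>; one factor |y| cancels.\<close>

lemma gram_section_lower_bound:
  assumes cols: "row_bounded \<F> v (mat_transpose A) a"
    and below: "\<And>x. x \<in> ell2 \<Longrightarrow> ell2_norm x \<le> K * ell2_norm (op_of_mat A x)"
    and K: "0 \<le> K" and C: "finite C"
  shows "L2_set (\<lambda>k. cmod (x k)) C
       \<le> K\<^sup>2 * L2_set (\<lambda>k. cmod (\<Sum>l\<in>C. mat_mult (mat_adjoint A) A k l * x l)) C"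
proof -
  let ?M = "mat_mult (mat_adjoint A) A"
  define y where "y k = (if k \<in> C then x k else 0)" for k
  define s where "s = L2_set (\<lambda>k. cmod (x k)) C"
  define t where "t = L2_set (\<lambda>k. cmod (\<Sum>l\<in>C. ?M k l * x l)) C"
  have y0: "y k = 0" if "k \<notin> C" for k using that by (simp add: y_def)
  have My: "(\<Sum>l\<in>C. ?M k l * y l) = (\<Sum>l\<in>C. ?M k l * x l)" for k
    by (intro sum.cong) (auto simp: y_def)
  have s: "L2_set (\<lambda>k. cmod (y k)) C = s"
    unfolding s_def by (intro L2_set_cong) (auto simp: y_def)
  have y: "y \<in> ell2" "ell2_norm y = s"
    using ell2_finite_support[OF C, of y] y0 s by auto
  have "(ell2_norm (op_of_mat A y))\<^sup>2 = (\<Sum>\<^sub>\<infinity>i. (cmod (op_of_mat A y i))\<^sup>2)"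
    by (simp add: ell2_norm_def infsum_nonneg)
  also have "\<dots> = cmod (\<Sum>k\<in>C. cnj (y k) * (\<Sum>l\<in>C. ?M k l * y l))"
    using gram_quadratic_form[of A a C y, OF cols C y0] by (simp add: infsum_nonneg)
  also have "\<dots> \<le> s * t"
    unfolding My using Cauchy_Schwarz_cnj_sum[of y _ C] by (simp add: s t_def)
  finally have Ay: "(ell2_norm (op_of_mat A y))\<^sup>2 \<le> s * t" .
  have "s\<^sup>2 \<le> (K * ell2_norm (op_of_mat A y))\<^sup>2"
    using below[OF y(1)] y(2) by (intro power_mono) (auto simp: s_def)
  also have "\<dots> \<le> K\<^sup>2 * (s * t)"
    unfolding power_mult_distrib by (intro mult_left_mono Ay) simp
  finally have "s * s \<le> s * (K\<^sup>2 * t)" by (simp add: power2_eq_square mult_ac)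
  moreover have "0 \<le> s" "0 \<le> t" by (auto simp: s_def t_def)
  ultimately have "s \<le> K\<^sup>2 * t" by (cases "s = 0") auto
  then show ?thesis by (simp add: s_def t_def)
qed

text \<open>Fubini: \<open>x\<close> is bounded, and A and its adjoint have bounded absolute row
  sums, so the double series converges absolutely.\<close>

lemma gram_op:
  assumes rows: "row_bounded \<F> v A a" and cols: "row_bounded \<F> v (mat_transpose A) a"
    and x: "x \<in> ell2"
  shows "op_of_mat (mat_mult (mat_adjoint A) A) x = op_of_mat (mat_adjoint A) (op_of_mat A x)"
proof
  fix j
  define e where "e = ell2_norm x"
  have e: "0 \<le> e" "cmod (x k) \<le> e" for k using cmod_le_ell2_norm[OF x] by (auto simp: e_def)
  have a: "0 \<le> c * a" using row_bounded_nonneg[OF rows] const_ge_1 by simp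
  have adj: "row_bounded \<F> v (mat_adjoint A) a"
    by (rule row_bounded_dominated[OF cols]) (simp add: mat_transpose_def mat_adjoint_def)
  note inner = row_bounded_abs_summable[OF rows e(2) e(1), where X=UNIV]
  \<comment> \<open>The inner absolute sums are at most \<open>c * a * e\<close> for every
    \<open>i\<close>, hence form a bounded sequence to which the adjoint applies.\<close>
  have outer: "(\<lambda>i. cmod (mat_adjoint A j i * of_real (\<Sum>\<^sub>\<infinity>m. cmod (A i m * x m)))) summable_on UNIV"
    by (rule row_bounded_abs_summable(1)[OF adj, where e = "c * a * e"])
      (use inner a e in \<open>auto simp: infsum_nonneg\<close>)
  have abs: "(\<lambda>(i, m). cmod (mat_adjoint A j i * (A i m * x m))) summable_on UNIV \<times> UNIV"
  proof (rule summable_on_SigmaI)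
    fix i
    show "((\<lambda>m. case (i, m) of (i, m) \<Rightarrow> cmod (mat_adjoint A j i * (A i m * x m))) has_sum
        cmod (mat_adjoint A j i * of_real (\<Sum>\<^sub>\<infinity>m. cmod (A i m * x m)))) UNIV"
      using has_sum_cmult_right[OF has_sum_infsum[OF inner(1)[of i]], of "cmod (mat_adjoint A j i)"]
      by (simp add: norm_mult infsum_nonneg)
  qed (use outer in auto)
  have sm: "(\<lambda>(i, m). mat_adjoint A j i * (A i m * x m)) summable_on UNIV \<times> UNIV"
    by (rule abs_summable_summable) (use abs in \<open>simp only: case_prod_unfold\<close>)
  have "op_of_mat (mat_adjoint A) (op_of_mat A x) j
      = (\<Sum>\<^sub>\<infinity>i. \<Sum>\<^sub>\<infinity>m. mat_adjoint A j i * (A i m * x m))"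
    by (simp add: op_of_mat_def infsum_cmult_right')
  also have "\<dots> = (\<Sum>\<^sub>\<infinity>m. \<Sum>\<^sub>\<infinity>i. mat_adjoint A j i * (A i m * x m))"
    by (rule infsum_swap_banach[OF sm])
  also have "\<dots> = op_of_mat (mat_mult (mat_adjoint A) A) x j"
    by (simp add: op_of_mat_def mat_mult_def mult.assoc[symmetric] infsum_cmult_left')
  finally show "op_of_mat (mat_mult (mat_adjoint A) A) x j
      = op_of_mat (mat_adjoint A) (op_of_mat A x) j" by simp
qed

section \<open>Recovering the inverse from finite sections of the Gram matrix\<close>

lemma FS_inverse_closed_imp_inverse_closed:
  assumes FS: "seq_inverse_closed N (FS_seqs N)"
  shows "inverse_closed N"
  unfolding inverse_closed_def
proof (intro ballI allI impI)
  fix A :: "(int ^ 'd) cmat" and T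
  assume "A \<in> mat_space N" and inv: "ell2_inverse A T"
  then obtain a where a: "0 \<le> a" "N A \<le> ennreal a" by (auto elim: mat_spaceE)
  then have rows: "row_bounded \<F> v A a" and cols: "row_bounded \<F> v (mat_transpose A) a"
    by (auto simp: N_le_iff)
  define M where "M = mat_mult (mat_adjoint A) A"
  define m where "m = c * a * a"
  have m: "0 \<le> m" "N M \<le> ennreal m"
    using a const_ge_1 N_mult N_adjoint by (auto simp: M_def m_def)
  then have rowM: "row_bounded \<F> v M m" by (simp add: N_le_iff)

  obtain K0 where K0: "\<And>x. x \<in> ell2 \<Longrightarrow> ell2_norm (T x) \<le> K0 * ell2_norm x"
    using inv unfolding ell2_inverse_def ell2_bounded_op_def by blast
  define K where "K = max K0 0"
  have K: "0 \<le> K" by (simp add: K_def)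
  \<comment> \<open>Boundedness of the inverse makes \<open>A\<close> bounded below, which gives all
    finite sections of \<open>M\<close> one common lower bound.\<close>
  have below: "ell2_norm x \<le> K * ell2_norm (op_of_mat A x)" if "x \<in> ell2" for x
  proof -
    have "op_of_mat A x \<in> ell2" "T (op_of_mat A x) = x"
      using inv that unfolding ell2_inverse_def ell2_bounded_op_def by blast+
    then have "ell2_norm x \<le> K0 * ell2_norm (op_of_mat A x)" using K0 by metis
    also have "\<dots> \<le> K * ell2_norm (op_of_mat A x)" by (intro mult_right_mono) (auto simp: K_def)
    finally show ?thesis .
  qed
  have lower: "L2_set (\<lambda>k. cmod (x k)) (cube n)
      \<le> K\<^sup>2 * L2_set (\<lambda>k. cmod (\<Sum>l\<in>cube n. M k l * x l)) (cube n)" for x n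
    unfolding M_def by (rule gram_section_lower_bound[OF cols below K finite_cube])

  have "\<exists>B. cube_inverse n (finite_section M n) B" for n
  proof -
    have inj: "\<forall>l\<in>cube n. x l = 0" if "\<forall>k\<in>cube n. (\<Sum>l\<in>cube n. M k l * x l) = 0" for x
    proof -
      have "L2_set (\<lambda>k. cmod (\<Sum>l\<in>cube n. M k l * x l)) (cube n) = 0"
        using that by (intro L2_set_0') auto
      then have "L2_set (\<lambda>k. cmod (x k)) (cube n) = 0"
        using lower[of x n] by (intro antisym) auto
      then show ?thesis by (subst (asm) L2_set_eq_0_iff) (auto simp: finite_cube)
    qed
    from injective_imp_two_sided_inverse[of "cube n" M, OF finite_cube inj]
    obtain B where "\<And>k l. k \<notin> cube n \<or> l \<notin> cube n \<Longrightarrow> B k l = 0"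
      "\<And>k l. k \<in> cube n \<Longrightarrow> l \<in> cube n \<Longrightarrow> (\<Sum>j\<in>cube n. M k j * B j l) = of_bool (k = l)"
      "\<And>k l. k \<in> cube n \<Longrightarrow> l \<in> cube n \<Longrightarrow> (\<Sum>j\<in>cube n. B k j * M j l) = of_bool (k = l)"
      by blast
    then show ?thesis
      by (intro exI[of _ B]) (auto simp: cube_inverse_def cube_mats_def finite_section_def)
  qed
  then obtain B where B: "\<And>n. cube_inverse n (finite_section M n) (B n)" by metis
  have Bcube: "B n k l = 0" if "k \<notin> cube n \<or> l \<notin> cube n" for n k l
    using B[of n] that by (auto simp: cube_inverse_def cube_mats_def)
  have MB: "(\<Sum>j\<in>cube n. M k j * B n j l) = of_bool (k = l)"
    and BM: "(\<Sum>j\<in>cube n. B n k j * M j l) = of_bool (k = l)"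
    if "k \<in> cube n" "l \<in> cube n" for n k l
    using B[of n] that by (auto simp: cube_inverse_def finite_section_def)

  \<comment> \<open>The lower bound is applied to the image of \<open>x\<close> under
    \<open>B n\<close>, which the section of \<open>M\<close> maps back to \<open>x\<close> on the
    cube.\<close>
  have "op_norm (B n) \<le> ennreal (K\<^sup>2)" for n
    unfolding op_norm_def
  proof (rule SUP_least)
    fix x :: "int ^ 'd \<Rightarrow> complex" assume "x \<in> {x \<in> ell2. ell2_norm x \<le> 1}"
    then have x: "x \<in> ell2" "ell2_norm x \<le> 1" by auto
    have op: "op_of_mat (B n) x k = (\<Sum>l\<in>cube n. B n k l * x l)" for k
      by (intro op_of_mat_finite_row finite_cube) (auto simp: Bcube)
    have "(\<Sum>l\<in>cube n. M k l * op_of_mat (B n) x l) = x k" if k: "k \<in> cube n" for k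
    proof -
      have "(\<Sum>l\<in>cube n. M k l * op_of_mat (B n) x l)
          = (\<Sum>j\<in>cube n. (\<Sum>l\<in>cube n. M k l * B n l j) * x j)"
        unfolding op sum_distrib_left sum_distrib_right by (subst sum.swap) (simp add: mult.assoc)
      also have "\<dots> = (\<Sum>j\<in>cube n. of_bool (k = j) * x j)"
        by (intro sum.cong refl) (simp add: MB k)
      also have "\<dots> = x k"
        using k by (simp add: finite_cube of_bool_def if_distrib[of "\<lambda>x. x * _"] cong: if_cong)
      finally show ?thesis .
    qed
    then have "L2_set (\<lambda>k. cmod (\<Sum>l\<in>cube n. M k l * op_of_mat (B n) x l)) (cube n)
        = L2_set (\<lambda>k. cmod (x k)) (cube n)" by (intro L2_set_cong) auto
    also have "\<dots> \<le> 1" using L2_set_le_ell2_norm[OF x(1) finite_cube, of n] x(2) by linarith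
    finally have "L2_set (\<lambda>k. cmod (op_of_mat (B n) x k)) (cube n) \<le> K\<^sup>2"
      using lower[of "op_of_mat (B n) x" n] by (smt (verit) mult_left_le zero_le_power2)
    moreover have "op_of_mat (B n) x k = 0" if "k \<notin> cube n" for k
      unfolding op using that by (simp add: Bcube)
    ultimately show "ennreal (ell2_norm (op_of_mat (B n) x)) \<le> ennreal (K\<^sup>2)"
      using ell2_finite_support(2)[OF finite_cube, of n "op_of_mat (B n) x"] by (simp add: ennreal_leI)
  qed
  \<comment> \<open>A single constant has to bound the norms of the sections and the operator norms
    of their inverses.\<close>
  then have "op_norm (B n) \<le> ennreal (max m (K\<^sup>2))" for n
    by (meson ennreal_leI max.cobounded2 order_trans)
  moreover have "N (finite_section M n) \<le> ennreal (max m (K\<^sup>2))" for n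
    using N_finite_section[OF m, of n] by (meson ennreal_leI max.cobounded1 order_trans)
  moreover have "finite_section M \<in> FS_seqs N"
    using mat_spaceI[OF m(2)] by (auto simp: FS_seqs_def)
  ultimately obtain C' where C': "\<And>n. N (B n) \<le> ennreal C'"
    using FS B unfolding seq_inverse_closed_def by blast
  define b where "b = max C' 0"
  have b: "0 \<le> b" "N (B n) \<le> ennreal b" for n
    using C'[of n] by (auto simp: b_def intro: order_trans ennreal_leI)
  then have rowB: "row_bounded \<F> v (B n) b" for n by (simp add: N_le_iff)

  \<comment> \<open>The inverse of \<open>A\<close> is the inverse of \<open>M\<close> times the
    adjoint of \<open>A\<close>; here \<open>B n\<close> replaces the inverse of
    \<open>M\<close>.\<close>
  define G where "G n = mat_mult (B n) (mat_adjoint A)" for n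
  have NG: "N (G n) \<le> ennreal (c * b * a)" for n
    unfolding G_def by (intro N_mult b N_adjoint a)
  have "(\<lambda>n. G n k l) \<longlonglongrightarrow> mat_of_op T k l" for k l
  proof -
    define \<delta> :: "int ^ 'd \<Rightarrow> complex" where "\<delta> j = of_bool (j = l)" for j
    \<comment> \<open>This is column \<open>l\<close> of the inverse of \<open>A\<close>, and
      \<open>M\<close> maps it to column \<open>l\<close> of the adjoint of
      \<open>A\<close>.\<close>
    define x where "x = T \<delta>"
    have "\<delta> \<in> ell2" by (rule ell2_finite_support(1)[of "{l}"]) (auto simp: \<delta>_def)
    then have x: "x \<in> ell2" "op_of_mat A x = \<delta>"
      using inv unfolding ell2_inverse_def ell2_bounded_op_def x_def by blast+
    have xkl: "mat_of_op T k l = x k" by (simp add: mat_of_op_def x_def \<delta>_def[abs_def])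
    have Mx: "(\<Sum>\<^sub>\<infinity>j. M i j * x j) = mat_adjoint A i l" for i
    proof -
      have "(\<Sum>\<^sub>\<infinity>j. M i j * x j) = op_of_mat (mat_adjoint A) \<delta> i"
        unfolding x(2)[symmetric] gram_op[OF rows cols x(1), symmetric]
        by (simp add: M_def op_of_mat_def)
      also have "\<dots> = mat_of_op (op_of_mat (mat_adjoint A)) i l"
        by (simp add: mat_of_op_def \<delta>_def[abs_def])
      finally show ?thesis by (simp add: mat_of_op_of_mat)
    qed
    \<comment> \<open>Column \<open>l\<close> of the adjoint is \<open>M\<close> applied to the part
      of \<open>x\<close> in the cube, plus a tail. On the cube, \<open>B n\<close> turns the first
      summand back into \<open>x\<close>; the tail is small in the supremum norm, for which the
      \<open>B n\<close> are uniformly bounded.\<close>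
    have err: "cmod (G n k l - x k) \<le> c * b * (c * m * e)"
      if k: "k \<in> cube n" and e: "0 \<le> e" and small: "\<And>j. j \<notin> cube n \<Longrightarrow> cmod (x j) \<le> e" for n e
    proof -
      have small': "\<And>j. j \<in> - cube n \<Longrightarrow> cmod (x j) \<le> e" using small by simp
      note tail = row_bounded_abs_summable[of M m "- cube n" x e, OF rowM small' e]
      define r where "r i = (\<Sum>\<^sub>\<infinity>j\<in>- cube n. M i j * x j)" for i
      have r: "cmod (r i) \<le> c * m * e" for i
        unfolding r_def
        by (rule order_trans[OF norm_infsum_bound[OF tail(1)] tail(2)])
      have split: "mat_adjoint A i l = (\<Sum>j\<in>cube n. M i j * x j) + r i" for i
      proof -
        have "(\<lambda>j. M i j * x j) summable_on - cube n"
          by (rule abs_summable_summable, rule tail(1))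
        then have "(\<Sum>\<^sub>\<infinity>j\<in>cube n \<union> - cube n. M i j * x j) = (\<Sum>j\<in>cube n. M i j * x j) + r i"
          unfolding r_def by (subst infsum_Un_disjoint) (auto simp: finite_cube)
        then show ?thesis by (simp add: Mx)
      qed
      have "(\<Sum>i\<in>cube n. B n k i * (\<Sum>j\<in>cube n. M i j * x j))
          = (\<Sum>j\<in>cube n. (\<Sum>i\<in>cube n. B n k i * M i j) * x j)"
        unfolding sum_distrib_left sum_distrib_right by (subst sum.swap) (simp add: mult.assoc)
      also have "\<dots> = (\<Sum>j\<in>cube n. of_bool (k = j) * x j)"
        by (intro sum.cong refl) (simp add: BM k)
      also have "\<dots> = x k"
        using k by (simp add: finite_cube of_bool_def if_distrib[of "\<lambda>x. x * _"] cong: if_cong)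
      finally have main: "(\<Sum>i\<in>cube n. B n k i * (\<Sum>j\<in>cube n. M i j * x j)) = x k" .
      have "G n k l = (\<Sum>i\<in>cube n. B n k i * mat_adjoint A i l)"
        unfolding G_def mat_mult_def
        by (intro infsumI has_sum_finite_neutralI) (auto simp: finite_cube Bcube)
      then have "G n k l - x k = (\<Sum>i\<in>cube n. B n k i * r i)"
        by (simp add: split ring_distribs sum.distrib main)
      also have "cmod \<dots> \<le> (\<Sum>i\<in>cube n. cmod (B n k i) * (c * m * e))"
        by (rule order_trans[OF norm_sum])
          (auto simp: norm_mult intro!: sum_mono mult_left_mono r)
      also have "\<dots> \<le> c * b * (c * m * e)"
        unfolding sum_distrib_right[symmetric]
        using const_ge_1 m e by (intro mult_right_mono row_sum_le rowB finite_cube) auto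
      finally show ?thesis .
    qed
    show ?thesis
      unfolding xkl
    proof (rule LIMSEQ_I)
      fix \<epsilon> :: real assume "0 < \<epsilon>"
      \<comment> \<open>The summand 1 keeps \<open>q\<close> positive and makes the final estimate
        strict.\<close>
      define q where "q = c * b * (c * m) + 1"
      have q: "0 < q" using const_ge_1 b m by (simp add: q_def add_nonneg_pos)
      define e where "e = \<epsilon> / q"
      have e: "0 < e" using \<open>0 < \<epsilon>\<close> q by (simp add: e_def)
      \<comment> \<open>Large cubes contain \<open>k\<close> and the finitely many indices where
        \<open>x\<close> has modulus at least \<open>e\<close>.\<close>
      obtain n0 where n0: "\<And>n. n0 \<le> n \<Longrightarrow> insert k {j. e \<le> cmod (x j)} \<subseteq> cube n"
        by (rule finite_subset_cube[of "insert k {j. e \<le> cmod (x j)}"])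
          (use ell2_finite_large[OF x(1) e] in auto)
      have "norm (G n k l - x k) < \<epsilon>" if "n0 \<le> n" for n
      proof -
        have "cmod (x j) \<le> e" if "j \<notin> cube n" for j
          using n0[OF \<open>n0 \<le> n\<close>] that by (cases "e \<le> cmod (x j)") auto
        moreover have "k \<in> cube n" using n0[OF that] by simp
        ultimately have "norm (G n k l - x k) \<le> c * b * (c * m * e)"
          using e by (intro err) auto
        also have "\<dots> < q * e" using e by (simp add: q_def algebra_simps)
        finally show ?thesis using q by (simp add: e_def)
      qed
      then show "\<exists>n0. \<forall>n\<ge>n0. norm (G n k l - x k) < \<epsilon>" by blast
    qed
  qed
  then have "N (mat_of_op T) \<le> ennreal (c * b * a)"
    by (rule N_limit[OF _ NG]) (use a b const_ge_1 in simp)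
  then show "mat_of_op T \<in> mat_space N" by (rule mat_spaceI)
qed

end

theorem theorem8:
  fixes v :: "int ^ 'd::finite \<Rightarrow> real"
    and N :: "(int ^ 'd) cmat \<Rightarrow> ennreal"
  assumes "admissible_weight v"
    and "N = schur_norm v \<or>
         (N = sup_norm v \<and>
          (\<lambda>k. \<bar>inverse (v k)\<bar>) summable_on UNIV \<and>
          (\<exists>C0::real. \<forall>k. convolution (\<lambda>l. inverse (v l)) (\<lambda>l. inverse (v l)) k
                           \<le> C0 * inverse (v k)))"
  shows "(inverse_closed N \<longleftrightarrow> seq_inverse_closed N (FS_seqs N)) \<and>
         (seq_inverse_closed N (FS_seqs N) \<longleftrightarrow> seq_inverse_closed N (F_seqs N))"
proof -
  obtain \<F> c where "solid_matrix_norm v N \<F> c"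
    using assms solid_matrix_norm_schur[OF assms(1)] solid_matrix_norm_sup[OF assms(1)] by blast
  then interpret solid_matrix_norm v N \<F> c .
  \<comment> \<open>The three implications form a cycle.\<close>
  show ?thesis
    using inverse_closed_imp_F_inverse_closed F_inverse_closed_imp_FS_inverse_closed
      FS_inverse_closed_imp_inverse_closed by blast
qed

end
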